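(* Let $F: \mathbb{R}^2 \to \mathbb{R}^2$ be an excellent smooth function with critical set $C$. Let $n\ge 1$ and let $\gamma_0, \gamma_1, \ldots, \gamma_n$ be positively oriented smooth simple closed curves bounding $\Delta_n$, a closed topological disk with $n$ holes, with $\Delta_n \cap C = \emptyset$. Assume $\gamma_0$ to be the outer connected component of the boundary of $\Delta_n$. Let $s = \operatorname{sgn}\det DF(p)$, $p \in \Delta_n$. Then $$ r(F(\gamma_0)) = r(F(\gamma_1)) + \cdots + r(F(\gamma_n)) - s(n-1). $$
   Context: For smooth $F:\mathbb{R}^2\to\mathbb{R}^2$, the critical set $C$ is the set of points $p$ where $DF(p)$ is not invertible. A critical point $p_f$ is a fold if there are local diffeomorphisms $\Psi$ (from a neighborhood of $p_f$ to a neighborhood of $0$, $\Psi(p_f)=0$) and $\Phi$ (from a neighborhood of $0$ to a neighborhood of $F(p_f)$, $\Phi(0)=F(p_f)$) with $F=\Phi\circ\tilde F\circ\Psi$ near $p_f$, where $\tilde F(x,y)=(x,y^2)$; a critical point is a cusp if the same holds with $\tilde F(x,y)=(x,y^3-xy)$. $F$ is excellent if all its critical points are folds or cusps. A closed topological disk with $n$ holes with boundary $\gamma_0,\dots,\gamma_n$, outer component $\gamma_0$, is the closed disk bounded by $\gamma_0$ minus the union of the open disks bounded by $\gamma_1,\dots,\gamma_n$, where the closed disks bounded by $\gamma_1,\dots,\gamma_n$ are pairwise disjoint and contained in the open disk bounded by $\gamma_0$. Each $\gamma_i$ is positively oriented, i.e. counterclockwise as a simple closed curve (all $\gamma_i$,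 including the inner ones). Let $\mathbb{S}^1$ be the unit circle and $e:[0,2\pi]\to\mathbb{S}^1$, $e(t)=(\cos t,\sin t)$. A parametrized regular closed curve (prc-curve) is a $C^1$ function $c:\mathbb{S}^1\to\mathbb{R}^2$ with $(c\circ e)'(t)\neq 0$ for all $t$. Its rotation number $r(c)$ is the winding number around $0$ of the closed curve $t\mapsto (c\circ e)'(t)$, $t\in[0,2\pi]$. It does not change under orientation preserving $C^1$ reparametrizations of $\mathbb{S}^1$, so one writes $r(\gamma)$ for an oriented curve $\gamma$; $F(\gamma_i)$ is oriented by the parametrization $F\circ c_i$, where $c_i$ is a regular parametrization of $\gamma_i$ compatible with its orientation, and $r(F(\gamma_i)) = r(F\circ c_i)$. $\operatorname{sgn}(x)=1$ for $x>0$ and $-1$ for $x<0$. *)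

theory Defs
  imports "HOL-Complex_Analysis.Complex_Analysis"
begin

text \<open>Smoothness (\<open>C\<^sup>k\<close> for every \<open>k\<close>), to be used on open sets only: all derivatives are taken
  in the whole space.\<close>

fun Ck_on :: "nat \<Rightarrow> 'a::euclidean_space set \<Rightarrow> ('a \<Rightarrow> 'b::real_normed_vector) \<Rightarrow> bool" where
  "Ck_on 0 S f \<longleftrightarrow> continuous_on S f"
| "Ck_on (Suc k) S f \<longleftrightarrow>
     (\<forall>x\<in>S. f differentiable (at x)) \<and> (\<forall>v. Ck_on k S (\<lambda>x. frechet_derivative f (at x) v))"

definition smooth_on :: "'a::euclidean_space set \<Rightarrow> ('a \<Rightarrow> 'b::real_normed_vector) \<Rightarrow> bool" where
  "smooth_on S f \<longleftrightarrow> (\<forall>k. Ck_on k S f)"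

definition diffeomorphism ::
    "'a::euclidean_space set \<Rightarrow> 'b::euclidean_space set \<Rightarrow> ('a \<Rightarrow> 'b) \<Rightarrow> bool" where
  "diffeomorphism U V f \<longleftrightarrow> open U \<and> open V \<and>
     (\<exists>g. homeomorphism U V f g \<and> smooth_on U f \<and> smooth_on V g)"

definition critical_set :: "(real^2 \<Rightarrow> real^2) \<Rightarrow> (real^2) set" where
  "critical_set F = {p. \<not> invertible (matrix (frechet_derivative F (at p)))}"

text \<open>\<open>F = \<Phi> \<circ> G \<circ> \<Psi>\<close> near \<open>p\<close>. The models \<open>G\<close> below are continuous with \<open>G 0 = 0\<close>, so
  \<open>G (\<Psi> x)\<close> lies in the domain \<open>W\<close> of \<open>\<Phi>\<close> for all \<open>x\<close> close to \<open>p\<close>.\<close>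

definition locally_equivalent_at ::
    "(real^2 \<Rightarrow> real^2) \<Rightarrow> (real^2 \<Rightarrow> real^2) \<Rightarrow> real^2 \<Rightarrow> bool" where
  "locally_equivalent_at G F p \<longleftrightarrow>
     (\<exists>\<Psi> \<Phi> U V W Z.
        diffeomorphism U V \<Psi> \<and> p \<in> U \<and> \<Psi> p = 0 \<and>
        diffeomorphism W Z \<Phi> \<and> 0 \<in> W \<and> \<Phi> 0 = F p \<and>
        (\<forall>\<^sub>F x in nhds p. F x = \<Phi> (G (\<Psi> x))))"

definition fold_point :: "(real^2 \<Rightarrow> real^2) \<Rightarrow> real^2 \<Rightarrow> bool" where
  "fold_point F p \<longleftrightarrow> p \<in> critical_set F \<and>
     locally_equivalent_at (\<lambda>v. vector [v$1, (v$2)^2]) F p"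

definition cusp_point :: "(real^2 \<Rightarrow> real^2) \<Rightarrow> real^2 \<Rightarrow> bool" where
  "cusp_point F p \<longleftrightarrow> p \<in> critical_set F \<and>
     locally_equivalent_at (\<lambda>v. vector [v$1, (v$2)^3 - v$1 * v$2]) F p"

definition excellent :: "(real^2 \<Rightarrow> real^2) \<Rightarrow> bool" where
  "excellent F \<longleftrightarrow> (\<forall>p\<in>critical_set F. fold_point F p \<or> cusp_point F p)"

definition circle_param :: "real \<Rightarrow> real^2" where
  "circle_param t = vector [cos t, sin t]"

text \<open>A function on the unit circle is represented by a function on the plane whose values off
  the circle are irrelevant. It is \<open>C\<^sup>1\<close> on the circle iff its pullback to the line, a periodic
  function, is \<open>C\<^sup>1\<close>.\<close>

definition prc_curve :: "(real^2 \<Rightarrow> real^2) \<Rightarrow> bool" where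
  "prc_curve c \<longleftrightarrow> (c \<circ> circle_param) C1_differentiable_on UNIV \<and>
     (\<forall>t. vector_derivative (c \<circ> circle_param) (at t) \<noteq> 0)"

definition complex_of_vec :: "real^2 \<Rightarrow> complex" where
  "complex_of_vec v = Complex (v$1) (v$2)"

text \<open>Winding number around \<open>z\<close> of a closed curve in the plane parametrized by \<open>[0, 2\<pi>]\<close>;
  paths in the library are parametrized by \<open>[0, 1]\<close>. The library's winding number is complex
  valued, but it is an integer for closed paths that avoid \<open>z\<close>.\<close>

definition plane_winding_number :: "(real \<Rightarrow> real^2) \<Rightarrow> real^2 \<Rightarrow> real" where
  "plane_winding_number g z =
     Re (winding_number (\<lambda>t. complex_of_vec (g (2 * pi * t))) (complex_of_vec z))"

definition rotation_number :: "(real^2 \<Rightarrow> real^2) \<Rightarrow> real" where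
  "rotation_number c =
     plane_winding_number (\<lambda>t. vector_derivative (c \<circ> circle_param) (at t)) 0"

definition smooth_simple_closed_curve :: "(real^2) set \<Rightarrow> bool" where
  "smooth_simple_closed_curve \<gamma> \<longleftrightarrow>
     (\<exists>c. smooth_on UNIV (c \<circ> circle_param) \<and> prc_curve c \<and>
          inj_on c (sphere 0 1) \<and> c ` sphere 0 1 = \<gamma>)"

text \<open>Regular parametrizations of a simple closed curve compatible with its counterclockwise
  orientation.\<close>

definition positive_parametrization :: "(real^2 \<Rightarrow> real^2) \<Rightarrow> (real^2) set \<Rightarrow> bool" where
  "positive_parametrization c \<gamma> \<longleftrightarrow>
     prc_curve c \<and> inj_on c (sphere 0 1) \<and> c ` sphere 0 1 = \<gamma> \<and>
     (\<forall>z\<in>inside \<gamma>. plane_winding_number (c \<circ> circle_param) z = 1)"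

definition closed_disk :: "(real^2) set \<Rightarrow> (real^2) set" where
  "closed_disk \<gamma> = \<gamma> \<union> inside \<gamma>"

definition bounds_disk_with_holes :: "nat \<Rightarrow> (nat \<Rightarrow> (real^2) set) \<Rightarrow> bool" where
  "bounds_disk_with_holes n \<gamma> \<longleftrightarrow>
     (\<forall>i\<in>{1..n}. closed_disk (\<gamma> i) \<subseteq> inside (\<gamma> 0)) \<and>
     disjoint_family_on (\<lambda>i. closed_disk (\<gamma> i)) {1..n}"

definition disk_with_holes :: "nat \<Rightarrow> (nat \<Rightarrow> (real^2) set) \<Rightarrow> (real^2) set" where
  "disk_with_holes n \<gamma> = closed_disk (\<gamma> 0) - (\<Union>i\<in>{1..n}. inside (\<gamma> i))"

end

theory Submission
  imports Defs
begin

text \<open>Write \<open>DF v = a * v + b * cnj v\<close> in complex notation, so that \<open>det DF = \<bar>a\<bar>\<^sup>2 - \<bar>b\<bar>\<^sup>2\<close>. According to the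
  sign \<open>s\<close>, the term with \<open>a\<close> or the one with \<open>b\<close> dominates, so the rotation number of \<open>F \<circ> c\<close> is the
  winding number of the dominating coefficient along \<open>c\<close> plus \<open>s\<close> times the rotation number of \<open>c\<close>. The
  latter is 1 by Hopf's Umlaufsatz. The dominating coefficient has no zero on the region, so its
  winding number along the outer curve is the sum of those along the inner ones: after division by a
  suitable product of powers of \<open>z - a\<^sub>i\<close>, with \<open>a\<^sub>i\<close> in the \<open>i\<close>-th hole, it has a continuous
  logarithm on every inner curve, extends by Tietze's theorem without zeros over the holes, and therefore
  has a continuous logarithm on the whole closed disk.\<close>

section \<open>Winding numbers and continuous logarithms\<close>

text \<open>The difference is continuous and takes values in the multiples of
  \<open>2 * pi * \<i>\<close>, which are at least \<open>2 * pi\<close> apart, so it is constant on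
  a connected set.\<close>

lemma exp_eq_imp_diff_constant:
  fixes f g :: "'a::topological_space \<Rightarrow> complex"
  assumes S: "connected S" and f: "continuous_on S f" and g: "continuous_on S g"
    and eq: "\<And>x. x \<in> S \<Longrightarrow> exp (f x) = exp (g x)"
  obtains k :: int where "\<And>x. x \<in> S \<Longrightarrow> f x = g x + 2 * of_real pi * \<i> * of_int k"
proof -
  have int: "\<exists>k::int. f x - g x = 2 * of_real pi * \<i> * of_int k" if "x \<in> S" for x
    using eq[OF that] unfolding exp_eq by (metis add_diff_cancel_left' mult.commute mult.left_commute of_int_mult of_int_numeral of_real_mult of_real_numeral of_real_of_int_eq)
  have "(\<lambda>x. f x - g x) constant_on S"
  proof (rule continuous_discrete_range_constant[OF S])
    show "continuous_on S (\<lambda>x. f x - g x)" by (intro continuous_intros f g)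
    fix x assume x: "x \<in> S"
    show "\<exists>e>0. \<forall>y. y \<in> S \<and> f y - g y \<noteq> f x - g x \<longrightarrow> e \<le> norm (f y - g y - (f x - g x))"
    proof (intro exI[of _ "2 * pi"] conjI allI impI)
      fix y assume y: "y \<in> S \<and> f y - g y \<noteq> f x - g x"
      obtain k l :: int where kl: "f x - g x = 2 * of_real pi * \<i> * of_int k"
        "f y - g y = 2 * of_real pi * \<i> * of_int l" using int x y by meson
      then have "l \<noteq> k" using y by auto
      then have "1 \<le> \<bar>of_int (l - k) :: real\<bar>" by linarith
      moreover have "f y - g y - (f x - g x) = of_real (2 * pi) * \<i> * of_int (l - k)"
        by (simp add: kl algebra_simps)
      then have "norm (f y - g y - (f x - g x)) = 2 * pi * \<bar>of_int (l - k)\<bar>"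
        by (simp only: norm_mult norm_of_real norm_of_int norm_ii) simp
      ultimately show "2 * pi \<le> norm (f y - g y - (f x - g x))" by simp
    qed simp
  qed
  then obtain d where d: "\<And>x. x \<in> S \<Longrightarrow> f x - g x = d" unfolding constant_on_def by blast
  show ?thesis
  proof (cases "S = {}")
    case False
    then obtain x where "x \<in> S" by blast
    then obtain k :: int where "d = 2 * of_real pi * \<i> * of_int k" using int d by metis
    then show ?thesis using d that by (metis diff_add_cancel add.commute)
  qed (use that in auto)
qed

text \<open>Any continuous logarithm of the path computes its winding number: it differs from the
  one behind \<open>winding_number_as_continuous_log\<close> by a constant, which cancels in the
  increment.\<close>

lemma winding_number_exp:
  assumes q: "continuous_on {0..1} q"
  shows "winding_number (\<lambda>t. exp (q t)) 0 = (q 1 - q 0) / (2 * of_real pi * \<i>)"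
proof -
  have p: "path (\<lambda>t. exp (q t))" unfolding path_def by (intro continuous_intros q)
  obtain r where r: "path r"
    "pathfinish r - pathstart r = 2 * of_real pi * \<i> * winding_number (\<lambda>t. exp (q t)) 0"
    "\<And>t. t \<in> {0..1} \<Longrightarrow> exp (q t) = 0 + exp (r t)"
    by (rule winding_number_as_continuous_log[OF p, of 0]) (auto simp: path_image_def)
  obtain k :: int where "\<And>x. x \<in> {0..1} \<Longrightarrow> q x = r x + 2 * of_real pi * \<i> * of_int k"
    using exp_eq_imp_diff_constant[of "{0..1}" q r] r q unfolding path_def
    by (metis add.left_neutral connected_Icc)
  then show ?thesis using r(2) by (auto simp: pathfinish_def pathstart_def field_simps)
qed

lemma path_log:
  assumes "continuous_on {0..1} f" and "\<And>t. t \<in> {0..1} \<Longrightarrow> f t \<noteq> (0::complex)"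
  obtains q where "continuous_on {0..1} q" "\<And>t. t \<in> {0..1} \<Longrightarrow> f t = exp (q t)"
    "q 1 - q 0 = 2 * of_real pi * \<i> * winding_number f 0"
proof (rule winding_number_as_continuous_log[of f 0])
  show "path f" "0 \<notin> path_image f" using assms by (force simp: path_def path_image_def)+
qed (auto simp: path_def pathfinish_def pathstart_def intro: that)

text \<open>Logarithms of the factors add up to a logarithm of the product, and increments are
  additive.\<close>

lemma winding_number_mult:
  assumes "continuous_on {0..1} f" and "\<And>t. t \<in> {0..1} \<Longrightarrow> f t \<noteq> 0"
    and "continuous_on {0..1} g" and "\<And>t. t \<in> {0..1} \<Longrightarrow> g t \<noteq> 0"
  shows "winding_number (\<lambda>t. f t * g t) 0 = winding_number f 0 + winding_number g 0"
proof -
  obtain q r where qr: "continuous_on {0..1} q" "\<And>t. t \<in> {0..1} \<Longrightarrow> f t = exp (q t)"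
    "q 1 - q 0 = 2 * of_real pi * \<i> * winding_number f 0"
    "continuous_on {0..1} r" "\<And>t. t \<in> {0..1} \<Longrightarrow> g t = exp (r t)"
    "r 1 - r 0 = 2 * of_real pi * \<i> * winding_number g 0"
    using path_log assms by metis
  have "winding_number (\<lambda>t. f t * g t) 0 = winding_number (\<lambda>t. exp (q t + r t)) 0"
    by (rule winding_number_cong) (simp add: qr exp_add)
  also have "\<dots> = (q 1 + r 1 - (q 0 + r 0)) / (2 * of_real pi * \<i>)"
    by (rule winding_number_exp) (intro continuous_intros qr)
  also have "\<dots> = ((q 1 - q 0) + (r 1 - r 0)) / (2 * of_real pi * \<i>)" by simp
  finally show ?thesis unfolding qr by (simp add: add_divide_distrib)
qed

text \<open>The dog-on-a-leash argument: \<open>f t / g t\<close> stays at distance less than 1 from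
  the point 1, hence in the right half-plane, where \<open>Ln\<close> is continuous. Along a closed
  loop this logarithm returns to its initial value, so the quotient contributes winding number
  0.\<close>

lemma winding_number_nearby_0:
  assumes f: "continuous_on {0..1} f" and g: "continuous_on {0..1} g"
    and near: "\<And>t. t \<in> {0..1} \<Longrightarrow> norm (f t - g t) < norm (g t)"
    and loops: "f 1 = f 0" "g 1 = g 0"
  shows "winding_number f 0 = winding_number g 0"
proof -
  have gnz: "g t \<noteq> 0" if "t \<in> {0..1}" for t using near[OF that] by auto
  have pos: "Re (f t / g t) > 0" if t: "t \<in> {0..1}" for t
  proof -
    have "norm (f t / g t - 1) < 1"
    proof -
      have "f t / g t - 1 = (f t - g t) / g t" using gnz[OF t] by (simp add: diff_divide_distrib)
      then show ?thesis using near[OF t] gnz[OF t] by (simp add: norm_divide)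
    qed
    then have "\<bar>Re (f t / g t - 1)\<bar> < 1" using abs_Re_le_cmod order_le_less_trans by blast
    then show ?thesis by simp
  qed
  have nonpos: "f t / g t \<notin> \<real>\<^sub>\<le>\<^sub>0" if "t \<in> {0..1}" for t
    using pos[OF that] by (auto simp: complex_nonpos_Reals_iff)
  have contq: "continuous_on {0..1} (\<lambda>t. f t / g t)" using gnz by (intro continuous_intros f g) auto
  have "winding_number (\<lambda>t. f t / g t) 0 = winding_number (\<lambda>t. exp (Ln (f t / g t))) 0"
    using nonpos by (intro winding_number_cong) (metis atLeastAtMost_iff exp_Ln nonpos_Reals_zero_I)
  also have "\<dots> = 0"
    using contq nonpos
    by (subst winding_number_exp) (auto intro!: continuous_on_Ln' simp: loops)
  finally have 0: "winding_number (\<lambda>t. f t / g t) 0 = 0" .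
  have "winding_number f 0 = winding_number (\<lambda>t. f t / g t * g t) 0"
    by (rule winding_number_cong) (use gnz in auto)
  also have "\<dots> = winding_number g 0"
    using 0 contq g gnz pos by (subst winding_number_mult) force+
  finally show ?thesis .
qed

section \<open>The Umlaufsatz\<close>

text \<open>For every \<open>h\<close>, including 0, the quotient is the integral of
  \<open>f' (s + h * \<tau>)\<close> over \<open>\<tau>\<close> from 0 to 1, and such an integral
  depends continuously on its parameters.\<close>

lemma continuous_on_difference_quotient:
  fixes f :: "real \<Rightarrow> complex"
  assumes deriv: "\<And>t. (f has_vector_derivative f' t) (at t)" and cont: "continuous_on UNIV f'"
  shows "continuous_on UNIV (\<lambda>(s, h). if h = 0 then f' s else (f (s + h) - f s) / of_real h)"
proof -
  have int: "((\<lambda>\<tau>. of_real h * f' (s + h * \<tau>)) has_integral (f (s + h) - f s)) {0..1}" for s h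
  proof -
    have "((\<lambda>\<tau>. f (s + h * \<tau>)) has_vector_derivative of_real h * f' (s + h * \<tau>)) (at \<tau> within {0..1})" for \<tau>
    proof -
      have "((f \<circ> (\<lambda>\<tau>. s + h * \<tau>)) has_vector_derivative h *\<^sub>R f' (s + h * \<tau>)) (at \<tau> within {0..1})"
        by (rule vector_diff_chain_within)
           (auto intro!: derivative_eq_intros has_vector_derivative_at_within[OF deriv])
      then show ?thesis by (simp add: o_def scaleR_conv_of_real)
    qed
    from fundamental_theorem_of_calculus[OF _ this] show ?thesis by simp
  qed
  have "continuous_on UNIV (\<lambda>x. integral (cbox 0 1) (\<lambda>\<tau>. f' (fst x + snd x * \<tau>)))"
    by (rule integral_continuous_on_param)
       (auto simp: case_prod_unfold intro!: continuous_intros continuous_on_compose2[OF cont])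
  moreover have "integral (cbox 0 1) (\<lambda>\<tau>. f' (fst x + snd x * \<tau>)) =
      (case x of (s, h) \<Rightarrow> if h = 0 then f' s else (f (s + h) - f s) / of_real h)" for x
  proof (cases x)
    case (Pair s h)
    have "of_real h * integral {0..1} (\<lambda>\<tau>. f' (s + h * \<tau>)) = f (s + h) - f s"
      using integral_unique[OF int[of h s]] by simp
    then show ?thesis using Pair by (auto simp: field_simps)
  qed
  ultimately show ?thesis by simp
qed

text \<open>Period 1 instead of \<open>2 * pi\<close>, in step with paths on \<open>[0, 1]\<close>,
  so that equality of points becomes integrality of the parameter difference.\<close>

definition circle_exp :: "real \<Rightarrow> complex" where
  "circle_exp t = exp (2 * of_real pi * \<i> * of_real t)"

lemma circle_exp_eq_circlepath: "circle_exp = circlepath 0 1"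
  by (auto simp: circle_exp_def circlepath mult_ac)

lemma norm_circle_exp [simp]: "norm (circle_exp t) = 1"
  by (simp add: circle_exp_def)

lemma circle_exp_nonzero [simp]: "circle_exp t \<noteq> 0"
  by (simp add: circle_exp_def)

lemma circle_exp_eq_iff: "circle_exp s = circle_exp t \<longleftrightarrow> s - t \<in> \<int>"
proof -
  have "2 * of_real pi * \<i> * of_real s = 2 * of_real pi * \<i> * of_real t + of_real (real_of_int (2 * n) * pi) * \<i>
      \<longleftrightarrow> s = t + of_int n" for n :: int
  proof -
    have "2 * of_real pi * \<i> * of_real t + of_real (real_of_int (2 * n) * pi) * \<i>
        = 2 * of_real pi * \<i> * of_real (t + of_int n)" by (simp add: algebra_simps)
    then show ?thesis by (simp del: of_real_add)
  qed
  then have "circle_exp s = circle_exp t \<longleftrightarrow> (\<exists>n::int. s = t + of_int n)"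
    unfolding circle_exp_def exp_eq by (simp only:)
  also have "\<dots> \<longleftrightarrow> s - t \<in> \<int>"
    unfolding Ints_def by (auto simp: algebra_simps)
  finally show ?thesis .
qed

lemma circle_exp_0 [simp]: "circle_exp 0 = 1" and circle_exp_1 [simp]: "circle_exp 1 = 1"
  by (auto simp: circle_exp_eq_circlepath circlepath_def part_circlepath_def linepath_def exp_eq_polar
     intro: complex_eqI)

lemma continuous_on_circle_exp [continuous_intros]:
  "continuous_on S f \<Longrightarrow> continuous_on S (\<lambda>x. circle_exp (f x))"
  unfolding circle_exp_def by (intro continuous_intros)

lemma circle_exp_has_vector_derivative:
  "(circle_exp has_vector_derivative 2 * of_real pi * \<i> * circle_exp t) (at t)"
  unfolding circle_exp_def[abs_def]
  by (auto intro!: derivative_eq_intros has_vector_derivative_real_field simp: algebra_simps)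

text \<open>Moving off the curve by \<open>\<eta> * g 0\<close> replaces the factor \<open>circle_exp t - 1\<close> by
  \<open>circle_exp t - (1 - \<eta>)\<close>, up to an error of smaller modulus than the product.\<close>

lemma winding_number_crossing:
  fixes g :: "real \<Rightarrow> complex"
  assumes g: "continuous_on {0..1} g" "\<And>t. t \<in> {0..1} \<Longrightarrow> g t \<noteq> 0" "g 1 = g 0"
    and c: "\<And>t. t \<in> {0..1} \<Longrightarrow> c t = c0 + (circle_exp t - 1) * g t"
  obtains \<epsilon> where "\<epsilon> > 0"
    "\<And>\<eta>. \<lbrakk>\<eta> \<noteq> 0; \<bar>\<eta>\<bar> < \<epsilon>\<rbrakk> \<Longrightarrow> c0 - of_real \<eta> * g 0 \<notin> c ` {0..1} \<and>
       winding_number c (c0 - of_real \<eta> * g 0) = winding_number g 0 + (if \<eta> > 0 then 1 else 0)"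
proof -
  \<comment> \<open>\<open>K\<close> collects the parameters where \<open>g t\<close> may be far
    from \<open>g 0\<close>. It is compact and avoids 0 and 1 because \<open>g 1 = g 0\<close>, so
    \<open>circle_exp t - 1\<close> has no zero on it.\<close>
  define K where "K = {t \<in> {0..1}. norm (g t) \<le> norm (g 0 - g t)}"
  have "closed K" unfolding K_def
    by (intro continuous_on_closed_Collect_le continuous_intros g(1))
  moreover have "{0..1} \<inter> K = K" by (auto simp: K_def)
  ultimately have "compact K" by (metis compact_Icc compact_Int_closed)
  have Knz: "circle_exp t \<noteq> 1" if "t \<in> K" for t
  proof
    assume "circle_exp t = 1"
    then have "t \<in> \<int>" using circle_exp_eq_iff[of t 0] by simp
    then have "t = 0 \<or> t = 1" using that by (auto simp: K_def Ints_def)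
    then show False using that g(2)[of t] g(3) by (auto simp: K_def)
  qed
  \<comment> \<open>The condition \<open>\<bar>\<eta>\<bar> < \<phi> t\<close> is exactly the
    estimate needed below, with the norm of \<open>d t\<close> replaced by its lower bound
    \<open>norm (circle_exp t - 1) - \<bar>\<eta>\<bar>\<close>.\<close>
  define \<phi> where "\<phi> t = norm (circle_exp t - 1) * norm (g t) / (norm (g t) + norm (g 0 - g t))" for t
  have "continuous_on {0..1} \<phi>" unfolding \<phi>_def
    using g(2) by (intro continuous_intros g(1)) (smt (verit) norm_ge_zero zero_less_norm_iff)
  then have cont: "continuous_on K \<phi>" by (rule continuous_on_subset) (auto simp: K_def)
  have pos: "\<phi> t > 0" if "t \<in> K" for t
    using that g(2)[of t] Knz[OF that] unfolding \<phi>_def K_def by (auto intro!: divide_pos_pos add_pos_nonneg)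
  obtain \<epsilon>0 where \<epsilon>0: "\<epsilon>0 > 0" "\<And>t. t \<in> K \<Longrightarrow> \<epsilon>0 \<le> \<phi> t"
  proof (cases "K = {}")
    case False
    then obtain m where "m \<in> K" "\<And>t. t \<in> K \<Longrightarrow> \<phi> m \<le> \<phi> t"
      using continuous_attains_inf[OF \<open>compact K\<close> False cont] by blast
    then show ?thesis using that pos by blast
  qed (use that[of 1] in auto)
  show ?thesis
  \<comment> \<open>The bound 1 keeps \<open>1 - \<eta>\<close> positive. Its distance from the unit
    circle is then \<open>\<bar>\<eta>\<bar>\<close>, and it lies inside the circle for positive
    \<open>\<eta>\<close> and outside for negative \<open>\<eta>\<close>.\<close>
  proof (rule that[of "min \<epsilon>0 1"])
    show "0 < min \<epsilon>0 1" using \<epsilon>0 by simp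
    fix \<eta> :: real assume \<eta>: "\<eta> \<noteq> 0" "\<bar>\<eta>\<bar> < min \<epsilon>0 1"
    define z where "z = c0 - of_real \<eta> * g 0"
    define d where "d t = circle_exp t - of_real (1 - \<eta>)" for t
    have d: "\<bar>\<eta>\<bar> \<le> norm (d t)" for t
    proof -
      have "norm (circle_exp t) - norm (of_real (1 - \<eta>) :: complex) \<le> norm (d t)"
        "norm (of_real (1 - \<eta>) :: complex) - norm (circle_exp t) \<le> norm (d t)"
        unfolding d_def by (metis norm_triangle_ineq2 norm_minus_commute)+
      then show ?thesis using \<eta> by (simp only: norm_of_real norm_circle_exp)
    qed
    have dnz: "d t \<noteq> 0" for t using d[of t] \<eta> by auto
    have near: "norm ((c t - z) - d t * g t) < norm (d t * g t)" if t: "t \<in> {0..1}" for t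
    proof -
      have "(c t - z) - d t * g t = of_real \<eta> * (g 0 - g t)"
        using c[OF t] by (simp add: z_def d_def algebra_simps)
      then have eq: "norm ((c t - z) - d t * g t) = \<bar>\<eta>\<bar> * norm (g 0 - g t)"
        by (simp add: norm_mult)
      show ?thesis
      \<comment> \<open>Off \<open>K\<close> the crude bound
        \<open>\<bar>\<eta>\<bar> \<le> norm (d t)\<close> suffices, since there \<open>g t\<close>
        is close to \<open>g 0\<close>; on \<open>K\<close> the choice of \<open>\<epsilon>0\<close>
        is used.\<close>
      proof (cases "t \<in> K")
        case False
        then have "norm (g 0 - g t) < norm (g t)" using t by (auto simp: K_def)
        then have "\<bar>\<eta>\<bar> * norm (g 0 - g t) < \<bar>\<eta>\<bar> * norm (g t)" using \<eta> by simp
        also have "\<dots> \<le> norm (d t) * norm (g t)" using d by (intro mult_right_mono) auto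
        finally show ?thesis by (simp add: eq norm_mult)
      next
        case True
        have p: "norm (g t) + norm (g 0 - g t) > 0" using g(2)[OF t] by (simp add: add_pos_nonneg)
        have "\<bar>\<eta>\<bar> < \<phi> t" using \<eta> \<epsilon>0(2)[OF True] by linarith
        then have "\<bar>\<eta>\<bar> * (norm (g t) + norm (g 0 - g t)) < norm (circle_exp t - 1) * norm (g t)"
          using p unfolding \<phi>_def by (simp add: pos_less_divide_eq)
        moreover have "norm (circle_exp t - 1) - \<bar>\<eta>\<bar> \<le> norm (d t)"
          using norm_triangle_ineq2[of "circle_exp t - 1" "- of_real \<eta>"] by (simp add: d_def algebra_simps)
        then have "(norm (circle_exp t - 1) - \<bar>\<eta>\<bar>) * norm (g t) \<le> norm (d t) * norm (g t)"
          by (intro mult_right_mono) auto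
        ultimately show ?thesis unfolding eq norm_mult by (simp add: algebra_simps)
      qed
    qed
    have contd: "continuous_on {0..1} d" unfolding d_def by (intro continuous_intros)
    have contc: "continuous_on {0..1} c"
      by (rule continuous_on_eq[where f="\<lambda>t. c0 + (circle_exp t - 1) * g t"])
         (auto intro!: continuous_intros g simp: c)
    have loop: "c 1 = c 0" using c[of 0] c[of 1] by simp
    have notin: "z \<notin> c ` {0..1}" using near by force
    have "winding_number c z = winding_number (\<lambda>t. c t - z) 0"
      by (rule winding_number_offset)
    also have "\<dots> = winding_number (\<lambda>t. d t * g t) 0"
      by (rule winding_number_nearby_0)
         (use near loop g(3) in \<open>auto intro!: continuous_intros contc contd g(1) simp: d_def\<close>)
    also have "\<dots> = winding_number d 0 + winding_number g 0"
      by (rule winding_number_mult) (use dnz g contd in auto)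
    also have "winding_number d 0 = winding_number (circlepath 0 1) (of_real (1 - \<eta>))"
      unfolding d_def circle_exp_eq_circlepath by (rule winding_number_offset[symmetric])
    also have "\<dots> = (if \<eta> > 0 then 1 else 0)"
    proof (cases "\<eta> > 0")
      case True
      have "cmod (of_real (1 - \<eta>) - 0) < 1" using True \<eta> by (simp only: norm_of_real diff_zero)
      then show ?thesis using True winding_number_circlepath by metis
    next
      case False
      have "winding_number (circlepath 0 1) (of_real (1 - \<eta>)) = 0"
      proof (rule winding_number_zero_outside[where s="cball 0 1"])
        have "1 < cmod (of_real (1 - \<eta>))" using False \<eta> by (simp only: norm_of_real)
        then show "complex_of_real (1 - \<eta>) \<notin> cball 0 1" by (simp del: of_real_diff)
      qed auto
      then show ?thesis using False by simp
    qed
    finally have "winding_number c z = winding_number g 0 + (if \<eta> > 0 then 1 else 0)" by simp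
    with notin show "c0 - of_real \<eta> * g 0 \<notin> c ` {0..1} \<and>
       winding_number c (c0 - of_real \<eta> * g 0) = winding_number g 0 + (if \<eta> > 0 then 1 else 0)"
      by (simp add: z_def)
  qed
qed

section \<open>Secants of a closed curve and Hopf's argument\<close>

lemma periodic_add_int:
  fixes f :: "real \<Rightarrow> 'a"
  assumes "\<And>t. f (t + 1) = f t"
  shows "f (t + of_int k) = f t"
proof -
  interpret periodic_fun_simple' f by standard (rule assms)
  show ?thesis by (rule plus_of_int)
qed

text \<open>Dividing by the secant of the circle rather than by \<open>t - s\<close> makes
  \<open>G\<close> periodic in each variable. Only the lines where \<open>t - s\<close> is an
  integer \<open>k\<close> need care: near such a line both secants are written as difference
  quotients \<open>D\<close> and \<open>E\<close> with step \<open>h = t - k - s\<close>, and the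
  factors \<open>h\<close> cancel.\<close>

lemma circle_secant_continuous:
  fixes c :: "real \<Rightarrow> complex"
  assumes deriv: "\<And>t. (c has_vector_derivative c' t) (at t)" and cont': "continuous_on UNIV c'"
    and per: "\<And>t. c (t + 1) = c t"
  defines "G \<equiv> \<lambda>(s, t). if t - s \<in> \<int> then c' s / (2 * of_real pi * \<i> * circle_exp s)
                   else (c t - c s) / (circle_exp t - circle_exp s)"
  shows "continuous_on UNIV G"
proof -
  define D where "D = (\<lambda>(s, h). if h = 0 then c' s else (c (s + h) - c s) / of_real h)"
  define E where "E = (\<lambda>(s, h). if h = 0 then 2 * of_real pi * \<i> * circle_exp s
     else (circle_exp (s + h) - circle_exp s) / of_real h)"
  have D: "continuous_on UNIV D" unfolding D_def
    by (rule continuous_on_difference_quotient[OF deriv cont'])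
  have E: "continuous_on UNIV E" unfolding E_def
    by (rule continuous_on_difference_quotient[OF circle_exp_has_vector_derivative]) (intro continuous_intros)
  have contc: "continuous_on UNIV c"
    using deriv by (meson continuous_at_imp_continuous_on has_vector_derivative_continuous)
  define U0 where "U0 = {x :: real \<times> real. circle_exp (snd x) \<noteq> circle_exp (fst x)}"
  define U where "U k = {x :: real \<times> real. \<bar>snd x - of_int k - fst x\<bar> < 1}" for k :: int
  have "open U0" unfolding U0_def by (intro open_Collect_neq continuous_intros)
  moreover have "open (U k)" for k unfolding U_def by (intro open_Collect_less continuous_intros)
  moreover have "continuous_on U0 G"
  proof (rule continuous_on_eq)
    show "continuous_on U0 (\<lambda>x. (c (snd x) - c (fst x)) / (circle_exp (snd x) - circle_exp (fst x)))"
      by (intro continuous_intros continuous_on_compose2[OF contc]) (auto simp: U0_def)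
    show "(c (snd x) - c (fst x)) / (circle_exp (snd x) - circle_exp (fst x)) = G x" if "x \<in> U0" for x
      using that by (auto simp: U0_def G_def circle_exp_eq_iff split: prod.split)
  qed
  moreover have "continuous_on (U k) G" for k
  proof (rule continuous_on_eq)
    \<comment> \<open>The strip \<open>U k\<close> is so narrow that 0 is the only integer value of
      \<open>h\<close> on it; hence the denominator \<open>E\<close> does not vanish there.\<close>
    have ball: "h = 0" if "\<bar>h\<bar> < 1" "h \<in> \<int>" for h :: real
      using that by (auto simp: Ints_def)
    have Enz: "E (s, h) \<noteq> 0" if "\<bar>h\<bar> < 1" for s h
      using ball[OF that] by (auto simp: E_def circle_exp_eq_iff)
    show "continuous_on (U k) (\<lambda>x. D (fst x, snd x - of_int k - fst x) / E (fst x, snd x - of_int k - fst x))"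
    proof (intro continuous_intros continuous_on_compose2[OF D] continuous_on_compose2[OF E])
      show "\<forall>x\<in>U k. E (fst x, snd x - real_of_int k - fst x) \<noteq> 0"
        by (auto simp: U_def Enz)
    qed auto
    show "D (fst x, snd x - of_int k - fst x) / E (fst x, snd x - of_int k - fst x) = G x" if "x \<in> U k" for x
    proof (cases x)
      case (Pair s t)
      define h where "h = t - of_int k - s"
      have "\<bar>h\<bar> < 1" using that Pair by (simp add: U_def h_def)
      have ts: "t = s + h + of_int k" by (simp add: h_def)
      have "c t = c (s + h)" unfolding ts by (rule periodic_add_int) (rule per)
      moreover have "circle_exp t = circle_exp (s + h)" by (simp add: circle_exp_eq_iff ts)
      moreover have "t - s \<in> \<int> \<longleftrightarrow> h = 0"
        using ball[OF \<open>\<bar>h\<bar> < 1\<close>] Ints_of_int[of k]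
        by (metis Ints_0 Ints_add Ints_diff add.assoc add_diff_cancel_left' add_diff_cancel_right' ts)
      ultimately show ?thesis
        by (auto simp: Pair G_def D_def E_def simp flip: h_def)
    qed
  qed
  moreover have "U0 \<union> (\<Union>k. U k) = UNIV"
  proof -
    have "x \<in> U0 \<union> (\<Union>k. U k)" for x
    proof (cases "x \<in> U0")
      case False
      then obtain k :: int where "snd x - fst x = of_int k" by (auto simp: U0_def circle_exp_eq_iff Ints_def)
      then have "x \<in> U k" by (simp add: U_def)
      then show ?thesis by blast
    qed auto
    then show ?thesis by blast
  qed
  ultimately show ?thesis
    by (metis continuous_on_open_UN continuous_on_open_Un open_UN)
qed

text \<open>The logarithm of the secant function of \<open>c\<close>, divided by that of the unit circle, is symmetric,
  so it grows by the same \<open>2 * pi * \<i> * a\<close> along both edges of the unit square and by twice that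
  amount along the diagonal. Just to the left and just to the right of the curve its winding number is
  \<open>a + 1\<close> and \<open>a\<close>; both lie in \<open>{0, 1}\<close>, so \<open>a = 0\<close>.\<close>

lemma umlaufsatz:
  fixes c :: "real \<Rightarrow> complex"
  assumes deriv: "\<And>t. (c has_vector_derivative c' t) (at t)" and cont': "continuous_on UNIV c'"
    and nz: "\<And>t. c' t \<noteq> 0" and per: "\<And>t. c (t + 1) = c t" and inj: "inj_on c {0..<1}"
    and inside: "\<And>z. z \<in> inside (c ` {0..1}) \<Longrightarrow> winding_number c z = 1"
  shows "winding_number c' 0 = 1"
proof -
  define G where "G \<equiv> \<lambda>(s, t). if t - s \<in> \<int> then c' s / (2 * of_real pi * \<i> * circle_exp s)
                   else (c t - c s) / (circle_exp t - circle_exp s)"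
  have ceq: "c s = c t \<longleftrightarrow> t - s \<in> \<int>" for s t
  proof
    assume "c s = c t"
    moreover have "c x = c (frac x)" for x
      using periodic_add_int[of c "frac x" "\<lfloor>x\<rfloor>", OF per] by (simp add: frac_def)
    ultimately have "c (frac s) = c (frac t)" by metis
    then have "frac s = frac t" using inj by (auto simp: inj_on_def frac_lt_1)
    then have "t - s = of_int (\<lfloor>t\<rfloor> - \<lfloor>s\<rfloor>)" by (simp add: frac_def)
    then show "t - s \<in> \<int>" by (metis Ints_of_int)
  next
    assume "t - s \<in> \<int>"
    then obtain k where "t = s + of_int k" by (auto simp: Ints_def algebra_simps)
    then show "c s = c t" using periodic_add_int[of c, OF per] by simp
  qed
  have per': "c' (t + 1) = c' t" for t
  proof -
    have "((\<lambda>t. t + 1) has_vector_derivative 1) (at t)" for t :: real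
      by (auto intro!: derivative_eq_intros)
    from vector_diff_chain_at[OF this deriv]
    have "((\<lambda>t. c (t + 1)) has_vector_derivative c' (t + 1)) (at t)" by (simp add: o_def)
    then have "(c has_vector_derivative c' (t + 1)) (at t)" by (simp add: per)
    then show ?thesis by (rule vector_derivative_unique_at[OF _ deriv])
  qed
  have Gcont: "continuous_on UNIV G" unfolding G_def
    by (rule circle_secant_continuous[OF deriv cont' per])
  have Gnz: "G x \<noteq> 0" for x
  proof (cases x)
    case (Pair s t)
    show ?thesis
    proof (cases "t - s \<in> \<int>")
      case True
      then show ?thesis by (simp add: G_def Pair nz)
    next
      case False
      then have "c t \<noteq> c s" "circle_exp t \<noteq> circle_exp s" using ceq[of s t] by (auto simp: circle_exp_eq_iff)
      then show ?thesis using False by (simp add: G_def Pair)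
    qed
  qed
  have Gsym: "G (s, t) = G (t, s)" for s t
  proof (cases "t - s \<in> \<int>")
    case True
    then obtain k where k: "t = s + of_int k" by (auto simp: Ints_def algebra_simps)
    have "c' t = c' s" unfolding k by (rule periodic_add_int) (rule per')
    moreover have "circle_exp t = circle_exp s" using True by (simp add: circle_exp_eq_iff)
    moreover have "s - t \<in> \<int>" using True by (metis Ints_minus minus_diff_eq)
    ultimately show ?thesis using True by (simp add: G_def)
  next
    case False
    moreover have "s - t \<notin> \<int>" using False by (metis Ints_minus minus_diff_eq)
    ultimately show ?thesis
      by (simp add: G_def) (metis minus_diff_eq minus_divide_divide)
  qed
  have Gper: "G (s, t + 1) = G (s, t)" for s t
  proof -
    have "t + 1 - s \<in> \<int> \<longleftrightarrow> t - s \<in> \<int>"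
      by (metis Ints_1 Ints_add Ints_diff add_diff_cancel_right' diff_add_eq)
    moreover have "circle_exp (t + 1) = circle_exp t" by (simp add: circle_exp_eq_iff)
    ultimately show ?thesis by (simp add: G_def per)
  qed
  \<comment> \<open>The parameter plane is contractible, so the zero-free function \<open>G\<close>
    has a continuous logarithm on all of it.\<close>
  obtain L where L: "continuous_on UNIV L" "\<And>x. G x = exp (L x)"
    using continuous_logarithm_on_contractible[OF Gcont _ Gnz] by (metis UNIV_I contractible_UNIV)
  have Lc: "continuous_on S (\<lambda>x. L (f x, g x))" if "continuous_on S f" "continuous_on S g" for S f g
    by (intro continuous_on_compose2[OF L(1)] continuous_intros that) auto
  have "continuous_on UNIV (\<lambda>x. L (snd x, fst x))" by (intro Lc continuous_intros)
  moreover have "exp (L x) = exp (L (snd x, fst x))" for x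
    using Gsym[of "fst x" "snd x"] by (simp only: L(2)) simp
  ultimately obtain k :: int where k: "\<And>x. x \<in> UNIV \<Longrightarrow> L x = L (snd x, fst x) + 2 * of_real pi * \<i> * of_int k"
    using exp_eq_imp_diff_constant[OF connected_UNIV L(1)] by blast
  \<comment> \<open>Swapping the coordinates fixes the diagonal, so evaluation at one diagonal point
    forces the constant to vanish.\<close>
  have "L (0, 0) = L (0, 0) + 2 * of_real pi * \<i> * of_int k" using k[of "(0,0)"] by simp
  then have "k = 0" by simp
  then have Lsym: "L (s, t) = L (t, s)" for s t using k[of "(s, t)"] by simp
  have "continuous_on UNIV (\<lambda>x. L (fst x, snd x + 1))" by (intro Lc continuous_intros)
  moreover have "exp (L (fst x, snd x + 1)) = exp (L x)" for x
    using Gper[of "fst x" "snd x"] by (simp only: L(2)) simp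
  ultimately obtain a :: int where a: "\<And>x. x \<in> UNIV \<Longrightarrow> L (fst x, snd x + 1) = L x + 2 * of_real pi * \<i> * of_int a"
    using exp_eq_imp_diff_constant[OF connected_UNIV _ L(1)] by blast
  have L01: "L (0, 1) = L (0, 0) + 2 * of_real pi * \<i> * of_int a" using a[of "(0,0)"] by simp
  \<comment> \<open>Go to \<open>(1, 1)\<close> through \<open>(1, 0)\<close>: by symmetry the first
    edge costs as much as the edge to \<open>(0, 1)\<close>, and the second edge is one more shift
    by the period.\<close>
  have L11: "L (1, 1) = L (0, 0) + 2 * (2 * of_real pi * \<i> * of_int a)"
    using a[of "(1,0)"] L01 Lsym[of 1 0] by simp
  have wn_edge: "winding_number (\<lambda>t. G (0, t)) 0 = of_int a"
    unfolding L(2) by (subst winding_number_exp) (auto intro!: Lc continuous_intros simp: L01)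
  have wn_diag: "winding_number (\<lambda>t. G (t, t)) 0 = 2 * of_int a"
    unfolding L(2) by (subst winding_number_exp) (auto intro!: Lc continuous_intros simp: L11)
  have wn_circle: "winding_number (\<lambda>t. 2 * of_real pi * \<i> * circle_exp t) 0 = 1"
  proof -
    have "winding_number (\<lambda>t. 2 * of_real pi * \<i> * circle_exp t) 0 =
        winding_number (\<lambda>t. exp (2 * of_real pi * \<i> * of_real t + Ln (2 * of_real pi * \<i>))) 0"
      by (rule winding_number_cong) (simp add: exp_add circle_exp_def)
    also have "\<dots> = 1" by (subst winding_number_exp) (auto intro!: continuous_intros)
    finally show ?thesis .
  qed
  \<comment> \<open>On the diagonal \<open>G\<close> is the ratio of \<open>c'\<close> to the
    velocity of the circle; multiplying that velocity back contributes the additional 1.\<close>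
  have "winding_number c' 0 = winding_number (\<lambda>t. G (t, t) * (2 * of_real pi * \<i> * circle_exp t)) 0"
    by (rule winding_number_cong) (auto simp: G_def circle_exp_def)
  also have "\<dots> = 2 * of_int a + 1"
    unfolding wn_diag[symmetric] wn_circle[symmetric]
    by (rule winding_number_mult)
       (auto simp: Gnz intro!: continuous_intros continuous_on_compose2[OF Gcont])
  finally have rot: "winding_number c' 0 = 2 * of_int a + 1" .
  define g where "g t = G (0, t)" for t
  have cg: "c t = c 0 + (circle_exp t - 1) * g t" for t
    using ceq[of 0 t] circle_exp_eq_iff[of t 0] by (auto simp: g_def G_def)
  have gcont: "continuous_on {0..1} g" unfolding g_def
    by (intro continuous_on_compose2[OF Gcont] continuous_intros) auto
  have gnz: "g t \<noteq> 0" for t by (simp add: g_def Gnz)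
  have g1: "g 1 = g 0" using Gper[of 0 0] by (simp add: g_def)
  obtain \<epsilon> where \<epsilon>: "\<epsilon> > 0"
    "\<And>\<eta>. \<lbrakk>\<eta> \<noteq> 0; \<bar>\<eta>\<bar> < \<epsilon>\<rbrakk> \<Longrightarrow> c 0 - of_real \<eta> * g 0 \<notin> c ` {0..1} \<and>
       winding_number c (c 0 - of_real \<eta> * g 0) = winding_number g 0 + (if \<eta> > 0 then 1 else 0)"
    using winding_number_crossing[OF gcont gnz g1 cg] by metis
  have wng: "winding_number g 0 = of_int a" using wn_edge by (simp add: g_def[abs_def])
  have path: "path c" "pathfinish c = pathstart c"
    using per[of 0] deriv unfolding path_def pathfinish_def pathstart_def
    by (auto intro: continuous_at_imp_continuous_on has_vector_derivative_continuous)
  have wn01: "winding_number c z \<in> {0, 1}" if "z \<notin> c ` {0..1}" for z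
  proof (cases "z \<in> inside (c ` {0..1})")
    case False
    then have "z \<in> outside (path_image c)"
      using that inside_Un_outside[of "c ` {0..1}"] unfolding path_image_def by blast
    then show ?thesis using winding_number_zero_in_outside path by simp
  qed (simp add: inside)
  have "(of_int a + 1 :: complex) \<in> {0, 1}"
    using \<epsilon>(2)[of "\<epsilon>/2"] wn01[of "c 0 - of_real (\<epsilon>/2) * g 0"] \<epsilon>(1) wng by simp
  moreover have "(of_int a :: complex) \<in> {0, 1}"
    using \<epsilon>(2)[of "-\<epsilon>/2"] wn01[of "c 0 - of_real (-\<epsilon>/2) * g 0"] \<epsilon>(1) wng by simp
  ultimately have "a = 0" by auto
  then show ?thesis using rot by simp
qed

section \<open>Zero-free functions on a disk with holes\<close>

lemma winding_number_powi:
  assumes "continuous_on {0..1} f" and "\<And>t. t \<in> {0..1} \<Longrightarrow> f t \<noteq> 0"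
  shows "winding_number (\<lambda>t. f t powi k) 0 = of_int k * winding_number f 0"
proof -
  obtain q where q: "continuous_on {0..1} q" "\<And>t. t \<in> {0..1} \<Longrightarrow> f t = exp (q t)"
    "q 1 - q 0 = 2 * of_real pi * \<i> * winding_number f 0"
    using path_log assms by metis
  have "winding_number (\<lambda>t. f t powi k) 0 = winding_number (\<lambda>t. exp (of_int k * q t)) 0"
    by (rule winding_number_cong) (simp add: q(2) exp_power_int)
  also have "\<dots> = of_int k * ((q 1 - q 0) / (2 * of_real pi * \<i>))"
    by (subst winding_number_exp) (auto intro!: continuous_intros q(1) simp: right_diff_distrib)
  finally show ?thesis by (simp only: q(3)) simp
qed

text \<open>This serves for the correction factor used below. Factors contribute additively, and a
  translation turns the winding of \<open>p t - a j\<close> around 0 into that of \<open>p\<close>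
  around \<open>a j\<close>.\<close>

lemma winding_number_prod_powi:
  fixes p :: "real \<Rightarrow> complex"
  assumes "finite J" and p: "continuous_on {0..1} p" and "\<And>j. j \<in> J \<Longrightarrow> a j \<notin> p ` {0..1}"
  shows "winding_number (\<lambda>t. \<Prod>j\<in>J. (p t - a j) powi k j) 0 = (\<Sum>j\<in>J. of_int (k j) * winding_number p (a j))"
  using assms(1,3)
proof (induction J rule: finite_induct)
  case empty
  show ?case using winding_number_exp[of "\<lambda>_. 0"] by simp
next
  case (insert i J)
  have nz: "p t - a j \<noteq> 0" if "j \<in> insert i J" "t \<in> {0..1}" for j t
    using insert.prems[OF that(1)] that(2) by (metis image_eqI right_minus_eq)
  have "winding_number (\<lambda>t. (p t - a i) powi k i * (\<Prod>j\<in>J. (p t - a j) powi k j)) 0 =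
      winding_number (\<lambda>t. (p t - a i) powi k i) 0 + winding_number (\<lambda>t. \<Prod>j\<in>J. (p t - a j) powi k j) 0"
    using nz insert.hyps by (intro winding_number_mult continuous_intros p) auto
  also have "winding_number (\<lambda>t. (p t - a i) powi k i) 0 = of_int (k i) * winding_number (\<lambda>t. p t - a i) 0"
    using nz by (intro winding_number_powi continuous_intros p) auto
  finally show ?case
    using insert by (simp flip: winding_number_offset)
qed

text \<open>Winding number 0 means that a logarithm \<open>q\<close> along the parameter interval
  has equal end values. Since a simple loop identifies only the end points, \<open>q\<close>
  descends to a function on the image.\<close>

lemma simple_loop_continuous_log:
  fixes p :: "real \<Rightarrow> complex"
  assumes p: "simple_path p" "pathfinish p = pathstart p"
    and h: "continuous_on (path_image p) h" "\<And>z. z \<in> path_image p \<Longrightarrow> h z \<noteq> (0::complex)"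
    and wn: "winding_number (h \<circ> p) 0 = 0"
  obtains l where "continuous_on (path_image p) l" "\<And>z. z \<in> path_image p \<Longrightarrow> h z = exp (l z)"
proof -
  have pcont: "continuous_on {0..1} p" using p(1) by (simp add: simple_path_def path_def)
  have im: "path_image p = p ` {0..1}" by (simp add: path_image_def)
  have "continuous_on {0..1} (h \<circ> p)"
    using h(1) pcont unfolding im by (intro continuous_on_compose)
  then obtain q where q: "continuous_on {0..1} q" "\<And>t. t \<in> {0..1} \<Longrightarrow> h (p t) = exp (q t)" "q 1 = q 0"
    using path_log[of "h \<circ> p"] h(2) wn unfolding im by force
  define l where "l z = q (SOME t. t \<in> {0..1} \<and> p t = z)" for z
  have l: "l (p t) = q t" if t: "t \<in> {0..1}" for t
  proof -
    define u where "u = (SOME u. u \<in> {0..1} \<and> p u = p t)"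
    have "u \<in> {0..1} \<and> p u = p t" unfolding u_def by (rule someI) (use t in auto)
    then have "u = t \<or> u = 0 \<and> t = 1 \<or> u = 1 \<and> t = 0"
      using p(1) t unfolding simple_path_def loop_free_def by blast
    then have "q u = q t" using q(3) by auto
    then show ?thesis by (simp add: l_def u_def)
  qed
  have clim: "compact (path_image p)" using pcont unfolding im by (intro compact_continuous_image) auto
  \<comment> \<open>A continuous map from a compact interval sends closed sets to closed sets, so
    the preimage of a closed set under \<open>l\<close>, being the image under \<open>p\<close> of
    its preimage under \<open>q\<close>, is closed.\<close>
  have "continuous_on (path_image p) l"
    unfolding continuous_on_closed_vimage[OF compact_imp_closed[OF clim]]
  proof (intro allI impI)
    fix B :: "complex set" assume B: "closed B"
    have "closed (q -` B \<inter> {0..1})" using q(1) B by (simp add: continuous_on_closed_vimage)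
    then have "compact ({0..1} \<inter> (q -` B \<inter> {0..1}))" by (intro compact_Int_closed) auto
    then have "compact (p ` ({0..1} \<inter> (q -` B \<inter> {0..1})))"
      by (rule compact_continuous_image[rotated]) (auto intro: continuous_on_subset[OF pcont])
    moreover have "p ` ({0..1} \<inter> (q -` B \<inter> {0..1})) = l -` B \<inter> path_image p"
      unfolding im using l by force
    ultimately show "closed (l -` B \<inter> path_image p)" using compact_imp_closed by metis
  qed
  moreover have "h z = exp (l z)" if "z \<in> path_image p" for z
    using that l q(2) unfolding im by auto
  ultimately show ?thesis using that by blast
qed

section \<open>Topology of a closed disk with holes in the complex plane\<close>

locale holed_disk =
  fixes n :: nat and c :: "nat \<Rightarrow> real \<Rightarrow> complex"
  assumes simple: "i \<le> n \<Longrightarrow> simple_path (c i)"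
    and loop: "i \<le> n \<Longrightarrow> pathfinish (c i) = pathstart (c i)"
    and wn_inside: "\<lbrakk>i \<le> n; z \<in> inside (path_image (c i))\<rbrakk> \<Longrightarrow> winding_number (c i) z = 1"
    and hole_inside: "i \<in> {1..n} \<Longrightarrow>
      path_image (c i) \<union> inside (path_image (c i)) \<subseteq> inside (path_image (c 0))"
    and holes_disjoint:
      "disjoint_family_on (\<lambda>i. path_image (c i) \<union> inside (path_image (c i))) {1..n}"
begin

definition disk :: "nat \<Rightarrow> complex set" where
  "disk i = path_image (c i) \<union> inside (path_image (c i))"

definition region :: "complex set" where
  "region = disk 0 - (\<Union>i\<in>{1..n}. inside (path_image (c i)))"

lemma path_c: "i \<le> n \<Longrightarrow> path (c i)"
  using simple by (rule simple_path_imp_path)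

lemma disks_disjoint: "\<lbrakk>i \<in> {1..n}; j \<in> {1..n}; i \<noteq> j\<rbrakk> \<Longrightarrow> disk i \<inter> disk j = {}"
  using holes_disjoint by (auto simp: disjoint_family_on_def disk_def)

lemma closed_disk_i: "i \<le> n \<Longrightarrow> closed (disk i)"
  unfolding disk_def using path_c by (rule closed_path_image_Un_inside)

lemma open_inside_c: "i \<le> n \<Longrightarrow> open (inside (path_image (c i)))"
  using path_c by (simp add: closed_path_image open_inside)

lemma closed_region: "closed region"
  unfolding region_def by (intro closed_Diff open_UN) (auto intro: closed_disk_i open_inside_c)

lemma region_inter_disk: "i \<in> {1..n} \<Longrightarrow> region \<inter> disk i \<subseteq> path_image (c i)"
  by (auto simp: region_def disk_def)

lemma path_image_subset_region:
  assumes "i \<le> n" shows "path_image (c i) \<subseteq> region"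
proof (cases "i = 0")
  case True
  have "path_image (c 0) \<inter> inside (path_image (c j)) = {}" if "j \<in> {1..n}" for j
    using hole_inside[OF that] inside_no_overlap[of "path_image (c 0)"] by blast
  then show ?thesis using True unfolding region_def disk_def by blast
next
  case False
  then have i: "i \<in> {1..n}" using assms by auto
  have "path_image (c i) \<inter> inside (path_image (c j)) = {}" if "j \<in> {1..n}" for j
    using disks_disjoint[OF i that] inside_no_overlap[of "path_image (c i)"] unfolding disk_def by blast
  then show ?thesis using hole_inside[OF i] unfolding region_def disk_def by blast
qed

lemma disk_0_eq: "disk 0 = region \<union> (\<Union>i\<in>{1..n}. disk i)"
  using hole_inside unfolding region_def disk_def by blast

text \<open>By the Jordan curve theorem the set is the closure of a connected set, the inside of the
  outer curve.\<close>

lemma connected_disk_0: "connected (disk 0)"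
proof -
  have "frontier (inside (path_image (c 0))) = path_image (c 0)" "connected (inside (path_image (c 0)))"
    using Jordan_inside_outside[of "c 0"] simple[of 0] loop[of 0] by auto
  then show ?thesis
    unfolding disk_def by (metis closure_Un_frontier connected_imp_connected_closure sup_commute)
qed

text \<open>Being Borsukian amounts to every continuous zero-free complex function on the set having
  a continuous logarithm. For a compact plane set this is equivalent to a connected complement,
  which here is the outside of a bounded set.\<close>

lemma Borsukian_disk_0: "Borsukian (disk 0)"
proof -
  have b: "bounded (path_image (c 0))" by (rule bounded_path_image) (simp add: path_c)
  have "bounded (disk 0)" unfolding disk_def using bounded_inside[OF b] b by simp
  then have "compact (disk 0)" using closed_disk_i[of 0] by (simp add: compact_eq_bounded_closed)
  moreover have "- disk 0 = outside (path_image (c 0))"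
    unfolding disk_def by (simp add: union_with_inside)
  moreover have "connected (outside (path_image (c 0)))" using b by (intro connected_outside) auto
  ultimately show ?thesis by (simp add: Borsukian_separation_compact)
qed

text \<open>Gluing along finitely many closed pieces: the region meets the closed disk of a hole
  only in its boundary curve, where the two functions agree. The \<open>THE\<close> picks a unique
  index because these closed disks are disjoint.\<close>

lemma extend_over_holes:
  fixes f :: "complex \<Rightarrow> 'b::topological_space"
  assumes f: "continuous_on region f" and g: "\<And>i. i \<in> {1..n} \<Longrightarrow> continuous_on (disk i) (g i)"
    and agree: "\<And>i z. \<lbrakk>i \<in> {1..n}; z \<in> path_image (c i)\<rbrakk> \<Longrightarrow> f z = g i z"
  obtains H where "continuous_on (disk 0) H" "\<And>z. z \<in> region \<Longrightarrow> H z = f z"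
    "\<And>i z. \<lbrakk>i \<in> {1..n}; z \<in> disk i\<rbrakk> \<Longrightarrow> H z = g i z"
proof -
  define H where "H z = (if z \<in> region then f z else g (THE i. i \<in> {1..n} \<and> z \<in> disk i) z)" for z
  have H1: "H z = f z" if "z \<in> region" for z using that by (simp add: H_def)
  have H2: "H z = g i z" if i: "i \<in> {1..n}" "z \<in> disk i" for i z
  proof (cases "z \<in> region")
    case True
    then show ?thesis using region_inter_disk i agree by (auto simp: H_def)
  next
    case False
    have "(THE i. i \<in> {1..n} \<and> z \<in> disk i) = i"
      using i disks_disjoint by blast
    then show ?thesis using False by (simp add: H_def)
  qed
  have "continuous_on (disk i) H" if "i \<in> {1..n}" for i
    using g[OF that] by (rule continuous_on_eq) (simp add: H2[OF that])
  then have "continuous_on (\<Union>i\<in>{1..n}. disk i) H"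
    by (intro continuous_on_closed_Union) (auto intro: closed_disk_i)
  moreover have "continuous_on region H" using f by (rule continuous_on_eq) (simp add: H1)
  moreover have "closed (\<Union>i\<in>{1..n}. disk i)" by (intro closed_UN) (auto intro: closed_disk_i)
  ultimately have "continuous_on (disk 0) H"
    unfolding disk_0_eq using closed_region by (intro continuous_on_closed_Un)
  then show ?thesis using that H1 H2 by blast
qed

text \<open>Connectedness is borrowed from the full disk: the sign is constant on each inner curve,
  extends over the hole by that constant, and so becomes a continuous function with finitely many
  values on the connected set \<open>disk 0\<close>.\<close>

lemma sgn_constant_on_region:
  fixes f :: "complex \<Rightarrow> real"
  assumes f: "continuous_on region f" "\<And>z. z \<in> region \<Longrightarrow> f z \<noteq> 0"
    and xy: "x \<in> region" "y \<in> region"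
  shows "sgn (f x) = sgn (f y)"
proof -
  have cont: "continuous_on region (\<lambda>z. sgn (f z))"
    using f by (auto intro!: continuous_intros)
  have fin: "finite (range (sgn :: real \<Rightarrow> real))"
    by (rule finite_subset[of _ "{-1, 0, 1}"]) (auto simp: sgn_real_def)
  have "(\<lambda>z. sgn (f z)) constant_on path_image (c i)" if "i \<in> {1..n}" for i
  proof (rule continuous_finite_range_constant)
    show "connected (path_image (c i))" using that by (intro connected_path_image path_c) auto
    show "continuous_on (path_image (c i)) (\<lambda>z. sgn (f z))"
      using cont by (rule continuous_on_subset) (use that in \<open>auto intro!: path_image_subset_region\<close>)
    show "finite ((\<lambda>z. sgn (f z)) ` path_image (c i))" by (rule finite_subset[OF _ fin]) auto
  qed
  then obtain v where v: "\<And>i z. \<lbrakk>i \<in> {1..n}; z \<in> path_image (c i)\<rbrakk> \<Longrightarrow> sgn (f z) = v i"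
    unfolding constant_on_def by metis
  obtain H where H: "continuous_on (disk 0) H" "\<And>z. z \<in> region \<Longrightarrow> H z = sgn (f z)"
    "\<And>i z. \<lbrakk>i \<in> {1..n}; z \<in> disk i\<rbrakk> \<Longrightarrow> H z = v i"
    by (rule extend_over_holes[OF cont, where g="\<lambda>i z. v i"]) (auto simp: v)
  have "H constant_on disk 0"
  proof (rule continuous_finite_range_constant[OF connected_disk_0 H(1)])
    have "H ` disk 0 \<subseteq> range sgn \<union> v ` {1..n}"
      unfolding disk_0_eq using H by auto
    then show "finite (H ` disk 0)" by (rule finite_subset) (simp add: fin)
  qed
  then show ?thesis using H(2) xy disk_0_eq unfolding constant_on_def by (metis UnI1)
qed

text \<open>An argument principle for functions that are merely continuous; topological extension
  over the holes takes the place of Cauchy's theorem.\<close>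

lemma winding_number_boundary_sum:
  assumes g: "continuous_on region g" "\<And>z. z \<in> region \<Longrightarrow> g z \<noteq> 0"
  shows "winding_number (g \<circ> c 0) 0 = (\<Sum>i=1..n. winding_number (g \<circ> c i) 0)"
proof -
  have pc: "continuous_on {0..1} (c i)" if "i \<le> n" for i
    using path_c[OF that] by (simp add: path_def)
  have cin: "c i t \<in> region" if "i \<le> n" "t \<in> {0..1}" for i t
    using path_image_subset_region[OF that(1)] that(2) by (auto simp: path_image_def)
  have gc: "continuous_on {0..1} (\<lambda>t. g (c i t))" if "i \<le> n" for i
    by (rule continuous_on_compose2[OF g(1) pc[OF that]]) (use cin that in auto)
  \<comment> \<open>The winding numbers are integers, so they can serve as exponents in
    \<open>P\<close>.\<close>
  have "\<exists>k::int. winding_number (g \<circ> c i) 0 = of_int k" if i: "i \<le> n" for i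
  proof -
    have "path (g \<circ> c i)" using gc[OF i] by (simp add: path_def o_def)
    moreover have "0 \<notin> path_image (g \<circ> c i)" using g(2) cin[OF i] by (auto simp: path_image_def)
    moreover have "pathfinish (g \<circ> c i) = pathstart (g \<circ> c i)"
      using loop[OF i] by (simp add: pathfinish_def pathstart_def)
    ultimately show ?thesis using integer_winding_number by (metis Ints_cases)
  qed
  then obtain k :: "nat \<Rightarrow> int" where k: "\<And>i. i \<le> n \<Longrightarrow> winding_number (g \<circ> c i) 0 = of_int (k i)"
    by metis
  have "\<exists>a. a \<in> inside (path_image (c i))" if "i \<le> n" for i
    using Jordan_inside_outside simple[OF that] loop[OF that] by blast
  then obtain a where a: "\<And>i. i \<le> n \<Longrightarrow> a i \<in> inside (path_image (c i))" by metis
  \<comment> \<open>Each inner curve \<open>c i\<close> winds once around \<open>a i\<close> and not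
    around the other points, so \<open>P\<close> has the same winding number as \<open>g\<close>
    along it. The outer curve winds once around every \<open>a j\<close>, so there \<open>P\<close>
    picks up the sum of all exponents.\<close>
  define P where "P z = (\<Prod>j=1..n. (z - a j) powi k j)" for z
  have a_notin: "a j \<notin> region" if "j \<in> {1..n}" for j
    using a[of j] that by (auto simp: region_def)
  have Pnz: "P z \<noteq> 0" if "z \<in> region" for z
    using a_notin that by (auto simp: P_def)
  have Pcont: "continuous_on region P"
    unfolding P_def using a_notin by (intro continuous_intros) auto
  have wnP: "winding_number (P \<circ> c i) 0 = (\<Sum>j=1..n. of_int (k j) * winding_number (c i) (a j))"
    if i: "i \<le> n" for i
  proof -
    have "a j \<notin> c i ` {0..1}" if "j \<in> {1..n}" for j
      using a_notin[OF that] cin[OF i] by (metis imageE)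
    from winding_number_prod_powi[where a=a and k=k, OF finite_atLeastAtMost pc[OF i] this]
    show ?thesis by (simp add: P_def o_def)
  qed
  have le0: "0 \<le> n" by simp
  have wnP0: "winding_number (P \<circ> c 0) 0 = (\<Sum>j=1..n. of_int (k j))"
  proof -
    have "winding_number (c 0) (a j) = 1" if j: "j \<in> {1..n}" for j
    proof (rule wn_inside[OF le0])
      have "a j \<in> inside (path_image (c j))" using j by (intro a) simp
      then show "a j \<in> inside (path_image (c 0))" using hole_inside[OF j] by blast
    qed
    then show ?thesis unfolding wnP[OF le0] by (intro sum.cong) auto
  qed
  have wnPi: "winding_number (P \<circ> c i) 0 = of_int (k i)" if i: "i \<in> {1..n}" for i
  proof -
    have le: "i \<le> n" using i by simp
    have "winding_number (c i) (a j) = (if j = i then 1 else 0)" if j: "j \<in> {1..n}" for j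
    proof (cases "j = i")
      case False
      then have "a j \<notin> disk i" using disks_disjoint[OF i j] a[of j] j by (auto simp: disk_def)
      then have "a j \<in> outside (path_image (c i))"
        using inside_Un_outside[of "path_image (c i)"] unfolding disk_def by blast
      then have "winding_number (c i) (a j) = 0"
        using winding_number_zero_in_outside path_c[OF le] loop[OF le] by blast
      then show ?thesis using False by simp
    next
      case True
      then show ?thesis using wn_inside[OF le a[OF le]] by simp
    qed
    then have "winding_number (P \<circ> c i) 0 = (\<Sum>j=1..n. if j = i then of_int (k j) else 0)"
      unfolding wnP[OF le] by (intro sum.cong) auto
    then show ?thesis using i by simp
  qed
  define h where "h z = g z / P z" for z
  have hcont: "continuous_on region h" unfolding h_def using Pnz by (intro continuous_intros g(1) Pcont) auto
  have hnz: "h z \<noteq> 0" if "z \<in> region" for z using that g(2) Pnz by (simp add: h_def)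
  have hc: "continuous_on {0..1} (\<lambda>t. h (c i t))" "continuous_on {0..1} (\<lambda>t. P (c i t))" if "i \<le> n" for i
    by (rule continuous_on_compose2[OF hcont pc[OF that]] continuous_on_compose2[OF Pcont pc[OF that]];
        use cin that in auto)+
  have split: "winding_number (g \<circ> c i) 0 = winding_number (h \<circ> c i) 0 + winding_number (P \<circ> c i) 0" if "i \<le> n" for i
  proof -
    have "winding_number (g \<circ> c i) 0 = winding_number (\<lambda>t. h (c i t) * P (c i t)) 0"
      by (rule winding_number_cong) (use Pnz cin that in \<open>auto simp: h_def\<close>)
    also have "\<dots> = winding_number (\<lambda>t. h (c i t)) 0 + winding_number (\<lambda>t. P (c i t)) 0"
      by (rule winding_number_mult) (use hc Pnz hnz cin that in auto)
    finally show ?thesis by (simp add: o_def)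
  qed
  have "\<exists>l. continuous_on UNIV l \<and> (\<forall>z\<in>path_image (c i). h z = exp (l z))" if i: "i \<in> {1..n}" for i
  proof -
    have le: "i \<le> n" using i by simp
    have "winding_number (h \<circ> c i) 0 = 0" using split[OF le] k[OF le] wnPi[OF i] by simp
    then obtain l where l: "continuous_on (path_image (c i)) l" "\<And>z. z \<in> path_image (c i) \<Longrightarrow> h z = exp (l z)"
      using simple_loop_continuous_log[OF simple[OF le] loop[OF le], of h] path_image_subset_region[OF le]
        hnz continuous_on_subset[OF hcont] by (metis subset_iff)
    \<comment> \<open>Tietze's theorem is applied to the logarithm rather than to \<open>h\<close>,
      so that the exponential of the extension has no zeros on the hole.\<close>
    have "closedin (top_of_set UNIV) (path_image (c i))" by (simp add: path_c[OF le] closed_path_image)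
    then obtain l' where "continuous_on UNIV l'" "\<And>z. z \<in> path_image (c i) \<Longrightarrow> l' z = l z"
      using Tietze_unbounded[OF l(1)] by blast
    then show ?thesis using l(2) by metis
  qed
  then obtain l where l: "\<And>i. i \<in> {1..n} \<Longrightarrow> continuous_on UNIV (l i)"
    "\<And>i z. \<lbrakk>i \<in> {1..n}; z \<in> path_image (c i)\<rbrakk> \<Longrightarrow> h z = exp (l i z)"
    by metis
  have "continuous_on (disk i) (\<lambda>z. exp (l i z))" if "i \<in> {1..n}" for i
    using l(1)[OF that] by (intro continuous_on_exp) (rule continuous_on_subset[OF _ subset_UNIV])
  then obtain H where H: "continuous_on (disk 0) H" "\<And>z. z \<in> region \<Longrightarrow> H z = h z"
    "\<And>i z. \<lbrakk>i \<in> {1..n}; z \<in> disk i\<rbrakk> \<Longrightarrow> H z = exp (l i z)"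
    using extend_over_holes[OF hcont, where g="\<lambda>i z. exp (l i z)"] l(2) by metis
  have "H z \<noteq> 0" if "z \<in> disk 0" for z
    using that H(2,3) hnz unfolding disk_0_eq by auto
  then obtain L where L: "continuous_on (disk 0) L" "\<And>z. z \<in> disk 0 \<Longrightarrow> H z = exp (L z)"
    using Borsukian_disk_0 H(1) unfolding Borsukian_continuous_logarithm by (metis ComplI Pi_I singletonD)
  have c0: "c 0 t \<in> disk 0" if "t \<in> {0..1}" for t using cin[of 0 t] that disk_0_eq by auto
  have hL: "(h \<circ> c 0) t = exp (L (c 0 t))" if "0 \<le> t" "t \<le> 1" for t
  proof -
    have t: "t \<in> {0..1}" using that by simp
    show ?thesis using H(2)[OF cin[OF le0 t]] L(2)[OF c0[OF t]] by simp
  qed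
  have Lcont: "continuous_on {0..1} (\<lambda>t. L (c 0 t))"
    by (rule continuous_on_compose2[OF L(1) pc[OF le0] image_subsetI[OF c0]])
  \<comment> \<open>The outer curve closes up, so the logarithm of \<open>h\<close> along it has
    equal end values.\<close>
  have "c 0 1 = c 0 0" using loop[OF le0] by (simp add: pathfinish_def pathstart_def)
  then have "winding_number (\<lambda>t. exp (L (c 0 t))) 0 = 0"
    using winding_number_exp[OF Lcont] by simp
  moreover have "winding_number (h \<circ> c 0) 0 = winding_number (\<lambda>t. exp (L (c 0 t))) 0"
    by (rule winding_number_cong) (rule hL)
  ultimately have "winding_number (h \<circ> c 0) 0 = 0" by simp
  then have "winding_number (g \<circ> c 0) 0 = (\<Sum>j=1..n. of_int (k j))"
    using split[OF le0] wnP0 by simp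
  also have "\<dots> = (\<Sum>i=1..n. winding_number (g \<circ> c i) 0)"
    by (rule sum.cong) (simp_all add: k)
  finally show ?thesis .
qed

end

section \<open>Rotation numbers of image curves\<close>

text \<open>The conjugate term has modulus \<open>norm (b t) * norm (w t)\<close>, less than that of
  \<open>a t * w t\<close>, so dropping it does not change the winding number.\<close>

lemma winding_number_conformal_dominates:
  fixes a b w :: "real \<Rightarrow> complex"
  assumes a: "continuous_on {0..1} a" and b: "continuous_on {0..1} b" and w: "continuous_on {0..1} w"
    and wnz: "\<And>t. t \<in> {0..1} \<Longrightarrow> w t \<noteq> 0" and loops: "a 1 = a 0" "b 1 = b 0" "w 1 = w 0"
    and dom: "\<And>t. t \<in> {0..1} \<Longrightarrow> norm (b t) < norm (a t)"
  shows "winding_number (\<lambda>t. a t * w t + b t * cnj (w t)) 0 = winding_number a 0 + winding_number w 0"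
proof -
  have anz: "a t \<noteq> 0" if "t \<in> {0..1}" for t using dom[OF that] by auto
  have "winding_number (\<lambda>t. a t * w t + b t * cnj (w t)) 0 = winding_number (\<lambda>t. a t * w t) 0"
  proof (rule winding_number_nearby_0)
    fix t :: real assume t: "t \<in> {0..1}"
    show "norm (a t * w t + b t * cnj (w t) - a t * w t) < norm (a t * w t)"
      using dom[OF t] wnz[OF t] by (simp add: norm_mult)
  qed (auto intro!: continuous_intros a b w simp: loops)
  also have "\<dots> = winding_number a 0 + winding_number w 0"
    by (rule winding_number_mult[OF a anz w wnz])
  finally show ?thesis .
qed

lemma winding_number_cnj_0:
  assumes w: "continuous_on {0..1} w" and wnz: "\<And>t. t \<in> {0..1} \<Longrightarrow> w t \<noteq> 0"
  shows "winding_number (\<lambda>t. cnj (w t)) 0 = - cnj (winding_number w 0)"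
  using winding_number_cnj[of w 0] assms by (force simp: o_def path_def path_image_def)

text \<open>The map \<open>f\<close> carries the complementary component of \<open>x\<close> into
  that of \<open>f x\<close>, which is bounded; applying the left inverse \<open>g\<close> bounds
  the component of \<open>x\<close>.\<close>

lemma inside_bounded_linear_vimage:
  fixes f :: "'a::euclidean_space \<Rightarrow> 'b::euclidean_space"
  assumes f: "bounded_linear f" and g: "bounded_linear g" and gf: "\<And>x. g (f x) = x"
    and x: "f x \<in> inside (f ` S)"
  shows "x \<in> inside S"
proof -
  let ?K = "connected_component_set (- S) x"
  have notin: "x \<notin> S" using x by (auto simp: inside_def)
  have "f ` ?K \<subseteq> connected_component_set (- (f ` S)) (f x)"
  proof (rule connected_component_maximal)
    show "connected (f ` ?K)"
      by (intro connected_continuous_image bounded_linear.continuous_on[OF f] continuous_on_id) simp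
    show "f ` ?K \<subseteq> - f ` S"
      using connected_component_subset[of "- S" x] by clarify (metis ComplD gf subsetD mem_Collect_eq)
    show "f x \<in> f ` ?K" using notin by simp
  qed
  moreover have "bounded (connected_component_set (- (f ` S)) (f x))" using x by (simp add: inside_def)
  ultimately have "bounded (f ` ?K)" by (rule bounded_subset[rotated])
  then have "bounded (g ` f ` ?K)" by (rule bounded_linear_image[OF _ g])
  then show ?thesis using notin by (simp add: inside_def image_image gf)
qed

section \<open>Identification of the real plane with the complex plane\<close>

definition vec_of_complex :: "complex \<Rightarrow> real^2" where
  "vec_of_complex z = vector [Re z, Im z]"

lemma vec_of_complex_of_vec [simp]: "vec_of_complex (complex_of_vec v) = v"
  by (simp add: vec_of_complex_def complex_of_vec_def vec_eq_iff forall_2)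

lemma complex_of_vec_of_complex [simp]: "complex_of_vec (vec_of_complex z) = z"
  by (simp add: vec_of_complex_def complex_of_vec_def)

lemma complex_of_vec_eq_iff [simp]: "complex_of_vec v = complex_of_vec w \<longleftrightarrow> v = w"
  by (metis vec_of_complex_of_vec)

lemma norm_complex_of_vec [simp]: "norm (complex_of_vec v) = norm v"
  by (simp add: complex_of_vec_def cmod_def norm_vec_def L2_set_def sum_2)

lemma bounded_linear_complex_of_vec: "bounded_linear complex_of_vec"
  by (rule bounded_linear_intro[of _ 1]) (auto simp: complex_of_vec_def complex_eq_iff simp flip: norm_complex_of_vec)

lemma bounded_linear_vec_of_complex: "bounded_linear vec_of_complex"
proof (rule bounded_linear_intro[of _ 1])
  show "norm (vec_of_complex z) \<le> norm z * 1" for z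
    using norm_complex_of_vec[of "vec_of_complex z"] by simp
qed (auto simp: vec_of_complex_def vec_eq_iff forall_2)

lemma complex_of_vec_0 [simp]: "complex_of_vec 0 = 0"
  by (simp add: complex_of_vec_def complex_eq_iff)

lemma inside_complex_of_vec: "inside (complex_of_vec ` S) = complex_of_vec ` inside S"
proof -
  have "complex_of_vec x \<in> inside (complex_of_vec ` S) \<longleftrightarrow> x \<in> inside S" for x
  proof
    assume "x \<in> inside S"
    then have "vec_of_complex (complex_of_vec x) \<in> inside (vec_of_complex ` complex_of_vec ` S)"
      by (simp add: image_image)
    then show "complex_of_vec x \<in> inside (complex_of_vec ` S)"
      by (rule inside_bounded_linear_vimage[OF bounded_linear_vec_of_complex bounded_linear_complex_of_vec, rotated]) simp
  next
    assume "complex_of_vec x \<in> inside (complex_of_vec ` S)"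
    then show "x \<in> inside S"
      by (rule inside_bounded_linear_vimage[OF bounded_linear_complex_of_vec bounded_linear_vec_of_complex, rotated]) simp
  qed
  then show ?thesis by (auto simp: image_iff) (metis complex_of_vec_of_complex)+
qed

lemma complex_of_vec_circle_param: "complex_of_vec (circle_param (2 * pi * t)) = circle_exp t"
  by (auto simp: complex_of_vec_def circle_param_def circle_exp_def exp_eq_polar complex_eq_iff Re_exp Im_exp)

lemma smooth_on_UNIV_frechet_derivative:
  assumes "smooth_on UNIV F"
  shows "(F has_derivative frechet_derivative F (at x)) (at x)"
    and "continuous_on UNIV (\<lambda>x. frechet_derivative F (at x) v)"
proof -
  have "Ck_on (Suc 0) UNIV F" using assms unfolding smooth_on_def by blast
  then show "(F has_derivative frechet_derivative F (at x)) (at x)"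
    "continuous_on UNIV (\<lambda>x. frechet_derivative F (at x) v)"
    by (auto simp: frechet_derivative_works)
qed

section \<open>Parametrized curves as complex paths\<close>

definition complex_loop :: "(real^2 \<Rightarrow> real^2) \<Rightarrow> real \<Rightarrow> complex" where
  "complex_loop c t = complex_of_vec (c (circle_param (2 * pi * t)))"

text \<open>The derivative is taken with respect to the angle, as in \<open>rotation_number\<close>.
  For a \<open>prc_curve\<close> it differs from the derivative of \<open>complex_loop c\<close> by
  the factor \<open>2 * pi\<close>.\<close>

definition complex_velocity :: "(real^2 \<Rightarrow> real^2) \<Rightarrow> real \<Rightarrow> complex" where
  "complex_velocity c t = complex_of_vec (vector_derivative (c \<circ> circle_param) (at (2 * pi * t)))"

lemma rotation_number_eq: "rotation_number c = Re (winding_number (complex_velocity c) 0)"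
  by (simp add: rotation_number_def plane_winding_number_def complex_velocity_def[abs_def])

lemma prc_curveD:
  assumes "prc_curve c"
  shows "((c \<circ> circle_param) has_vector_derivative vector_derivative (c \<circ> circle_param) (at t)) (at t)"
    and "continuous_on UNIV (complex_velocity c)" and "complex_velocity c t \<noteq> 0"
    and "(complex_loop c has_vector_derivative of_real (2 * pi) * complex_velocity c t) (at t)"
proof -
  have C1: "\<And>t. (c \<circ> circle_param) differentiable at t"
    and cont: "continuous_on UNIV (\<lambda>t. vector_derivative (c \<circ> circle_param) (at t))"
    and nz: "\<And>t. vector_derivative (c \<circ> circle_param) (at t) \<noteq> 0"
    using assms by (auto simp: prc_curve_def C1_differentiable_on_eq)
  have d: "((c \<circ> circle_param) has_vector_derivative vector_derivative (c \<circ> circle_param) (at t)) (at t)" for t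
    using C1 vector_derivative_works by blast
  then show "((c \<circ> circle_param) has_vector_derivative vector_derivative (c \<circ> circle_param) (at t)) (at t)" .
  show "continuous_on UNIV (complex_velocity c)"
    unfolding complex_velocity_def[abs_def]
    by (intro bounded_linear.continuous_on[OF bounded_linear_complex_of_vec]
        continuous_on_compose2[OF cont] continuous_intros) auto
  show "complex_velocity c t \<noteq> 0"
    using nz[of "2 * pi * t"] complex_of_vec_eq_iff[of _ 0] by (simp add: complex_velocity_def del: complex_of_vec_eq_iff)
  have "((\<lambda>t. 2 * pi * t) has_vector_derivative 2 * pi) (at t)"
    by (auto intro!: derivative_eq_intros)
  from vector_diff_chain_at[OF this d]
  have "((\<lambda>t. c (circle_param (2 * pi * t))) has_vector_derivative
      (2 * pi) *\<^sub>R vector_derivative (c \<circ> circle_param) (at (2 * pi * t))) (at t)"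
    by (simp add: o_def)
  from bounded_linear.has_vector_derivative[OF bounded_linear_complex_of_vec this]
  show "(complex_loop c has_vector_derivative of_real (2 * pi) * complex_velocity c t) (at t)"
    unfolding linear_scale[OF bounded_linear.linear[OF bounded_linear_complex_of_vec]]
    by (simp add: complex_loop_def[abs_def] complex_velocity_def scaleR_conv_of_real)
qed

lemma complex_loop_periodic: "complex_loop c (t + 1) = complex_loop c t"
proof -
  have "circle_param (2 * pi * (t + 1)) = circle_param (2 * pi * t)"
    by (simp add: circle_param_def distrib_left)
  then show ?thesis by (simp add: complex_loop_def)
qed

lemma complex_velocity_periodic:
  assumes "prc_curve c" shows "complex_velocity c (t + 1) = complex_velocity c t"
proof -
  have "((\<lambda>t. t + 1) has_vector_derivative 1) (at t)" for t :: real
    by (auto intro!: derivative_eq_intros)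
  from vector_diff_chain_at[OF this prc_curveD(4)[OF assms]]
  have "(complex_loop c has_vector_derivative of_real (2 * pi) * complex_velocity c (t + 1)) (at t)"
    by (simp add: o_def complex_loop_periodic)
  from vector_derivative_unique_at[OF this prc_curveD(4)[OF assms]] show ?thesis by simp
qed

lemma circle_param_image: "(\<lambda>t. circle_param (2 * pi * t)) ` {0..1} = sphere 0 1"
proof -
  have "circle_exp ` {0..1} = sphere 0 1"
    using path_image_circlepath[of 0 1] by (simp add: circle_exp_eq_circlepath path_image_def)
  then have eq: "complex_of_vec ` (\<lambda>t. circle_param (2 * pi * t)) ` {0..1} = sphere 0 1"
    by (simp add: image_image complex_of_vec_circle_param)
  show ?thesis
  proof (intro equalityI subsetI)
    fix v :: "real^2" assume "v \<in> sphere 0 1"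
    then have "complex_of_vec v \<in> sphere 0 1" by simp
    then show "v \<in> (\<lambda>t. circle_param (2 * pi * t)) ` {0..1}" unfolding eq[symmetric] by auto
  next
    fix v assume "v \<in> (\<lambda>t. circle_param (2 * pi * t)) ` {0..1}"
    then have "complex_of_vec v \<in> sphere 0 1" unfolding eq[symmetric] by blast
    then show "v \<in> sphere 0 1" by simp
  qed
qed

lemma circle_param_sphere: "circle_param (2 * pi * t) \<in> sphere 0 1"
  using norm_complex_of_vec[of "circle_param (2 * pi * t)"] by (simp add: complex_of_vec_circle_param)

lemma positive_parametrizationD:
  assumes "positive_parametrization c \<gamma>"
  shows "complex_loop c s = complex_loop c t \<longleftrightarrow> s - t \<in> \<int>"
    and "path (complex_loop c)" and "pathfinish (complex_loop c) = pathstart (complex_loop c)"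
    and "path_image (complex_loop c) = complex_of_vec ` \<gamma>"
    and "z \<in> inside (path_image (complex_loop c)) \<Longrightarrow> winding_number (complex_loop c) z = 1"
proof -
  have prc: "prc_curve c" and inj: "inj_on c (sphere 0 1)" and im: "c ` sphere 0 1 = \<gamma>"
    and wn: "\<And>z. z \<in> inside \<gamma> \<Longrightarrow> plane_winding_number (c \<circ> circle_param) z = 1"
    using assms by (auto simp: positive_parametrization_def)
  have "complex_loop c s = complex_loop c t \<longleftrightarrow> circle_param (2 * pi * s) = circle_param (2 * pi * t)"
    using inj_on_eq_iff[OF inj circle_param_sphere circle_param_sphere] by (simp add: complex_loop_def)
  also have "\<dots> \<longleftrightarrow> circle_exp s = circle_exp t"
    by (simp flip: complex_of_vec_circle_param)
  finally show "complex_loop c s = complex_loop c t \<longleftrightarrow> s - t \<in> \<int>" by (simp add: circle_exp_eq_iff)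
  show path: "path (complex_loop c)"
    unfolding path_def using prc_curveD(4)[OF prc]
    by (auto intro: continuous_at_imp_continuous_on has_vector_derivative_continuous)
  show loop: "pathfinish (complex_loop c) = pathstart (complex_loop c)"
    using complex_loop_periodic[of c 0] by (simp add: pathfinish_def pathstart_def)
  show pim: "path_image (complex_loop c) = complex_of_vec ` \<gamma>"
    unfolding im[symmetric] circle_param_image[symmetric]
    by (simp add: path_image_def image_image complex_loop_def[abs_def])
  assume z: "z \<in> inside (path_image (complex_loop c))"
  then obtain v where v: "v \<in> inside \<gamma>" "z = complex_of_vec v"
    unfolding pim inside_complex_of_vec by blast
  \<comment> \<open>The orientation condition fixes only the real part; integrality of the winding
    number of a closed path removes the imaginary part.\<close>
  have "Re (winding_number (complex_loop c) z) = 1"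
    using wn[OF v(1)] by (simp add: plane_winding_number_def v(2) complex_loop_def[abs_def])
  moreover have "z \<notin> path_image (complex_loop c)" using z by (simp add: inside_def)
  then have "winding_number (complex_loop c) z \<in> \<int>" using integer_winding_number path loop by blast
  ultimately show "winding_number (complex_loop c) z = 1" by (auto simp: Ints_def)
qed

text \<open>The Umlaufsatz applies to the parametrization with period 1, whose derivative is
  \<open>2 * pi\<close> times the velocity; this constant factor has winding number 0.\<close>

lemma winding_number_velocity:
  assumes "positive_parametrization c \<gamma>"
  shows "winding_number (complex_velocity c) 0 = 1"
proof -
  have prc: "prc_curve c" using assms by (simp add: positive_parametrization_def)
  have 1: "winding_number (\<lambda>t. of_real (2 * pi) * complex_velocity c t) 0 = 1"
  proof (rule umlaufsatz)
    show "inj_on (complex_loop c) {0..<1}"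
    proof (rule inj_onI)
      fix s t :: real assume st: "s \<in> {0..<1}" "t \<in> {0..<1}" "complex_loop c s = complex_loop c t"
      then obtain k :: int where k: "s - t = of_int k"
        using positive_parametrizationD(1)[OF assms] by (auto simp: Ints_def)
      then have "k = 0" using st by auto
      then show "s = t" using k by simp
    qed
    show "winding_number (complex_loop c) z = 1" if "z \<in> inside (complex_loop c ` {0..1})" for z
      using positive_parametrizationD(5)[OF assms] that by (simp add: path_image_def)
    show "continuous_on UNIV (\<lambda>t. of_real (2 * pi) * complex_velocity c t)"
      by (intro continuous_intros prc_curveD(2)[OF prc])
  qed (use prc_curveD(3,4)[OF prc] complex_loop_periodic in auto)
  have "winding_number (\<lambda>t. of_real (2 * pi) * complex_velocity c t) 0
      = winding_number (\<lambda>t. of_real (2 * pi)) 0 + winding_number (complex_velocity c) 0"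
    by (rule winding_number_mult)
       (use prc_curveD(3)[OF prc] in \<open>auto intro: continuous_on_subset[OF prc_curveD(2)[OF prc]]\<close>)
  moreover have "winding_number (\<lambda>t. of_real (2 * pi)) 0 = 0"
    using winding_number_exp[of "\<lambda>_. Ln (of_real (2 * pi))"] by simp
  ultimately show ?thesis using 1 by simp
qed


section \<open>Complex-linear and antilinear parts of the derivative\<close>

definition linear_part :: "(real^2 \<Rightarrow> real^2) \<Rightarrow> complex" where
  "linear_part A = (complex_of_vec (A (axis 1 1)) - \<i> * complex_of_vec (A (axis 2 1))) / 2"

text \<open>When \<open>A\<close> is the derivative of a plane map, \<open>linear_part A\<close> and
  this are its Wirtinger derivatives with respect to \<open>z\<close> and
  \<open>cnj z\<close>.\<close>

definition antilinear_part :: "(real^2 \<Rightarrow> real^2) \<Rightarrow> complex" where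
  "antilinear_part A = (complex_of_vec (A (axis 1 1)) + \<i> * complex_of_vec (A (axis 2 1))) / 2"

lemma linear_antilinear_decomposition:
  assumes A: "bounded_linear A"
  shows "complex_of_vec (A v) = linear_part A * complex_of_vec v + antilinear_part A * cnj (complex_of_vec v)"
proof -
  interpret bounded_linear "\<lambda>v. complex_of_vec (A v)"
    by (rule bounded_linear_compose[OF bounded_linear_complex_of_vec A])
  define a b where "a = complex_of_vec (A (axis 1 1))" and "b = complex_of_vec (A (axis 2 1))"
  have "v = (v$1) *\<^sub>R axis 1 1 + (v$2) *\<^sub>R axis 2 1"
    by (simp add: vec_eq_iff forall_2 axis_def)
  then have "complex_of_vec (A v) = complex_of_vec (A ((v$1) *\<^sub>R axis 1 1 + (v$2) *\<^sub>R axis 2 1))" by simp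
  also have "\<dots> = of_real (v$1) * a + of_real (v$2) * b"
    by (simp add: add scaleR a_def b_def) (simp add: scaleR_conv_of_real)
  also have "\<dots> = (a - \<i> * b) / 2 * complex_of_vec v + (a + \<i> * b) / 2 * cnj (complex_of_vec v)"
    by (simp add: complex_of_vec_def complex_eq_iff field_simps)
  finally show ?thesis by (simp add: linear_part_def antilinear_part_def a_def b_def)
qed

text \<open>This turns the sign of the Jacobian into a comparison of moduli and so decides which of
  the two parts dominates.\<close>

lemma det_eq_linear_antilinear:
  "det (matrix A) = (norm (linear_part A))\<^sup>2 - (norm (antilinear_part A))\<^sup>2"
  by (simp add: det_2 matrix_def linear_part_def antilinear_part_def complex_of_vec_def cmod_power2
      norm_divide power_divide) (simp add: field_simps power2_eq_square)

lemma complex_velocity_image: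
  assumes F: "smooth_on UNIV F" and c: "prc_curve c"
  shows "complex_velocity (F \<circ> c) t =
    complex_of_vec (frechet_derivative F (at (vec_of_complex (complex_loop c t))) (vec_of_complex (complex_velocity c t)))"
proof -
  have "(F has_derivative frechet_derivative F (at ((c \<circ> circle_param) u)))
      (at ((c \<circ> circle_param) u) within range (c \<circ> circle_param))" for u
    by (rule has_derivative_at_withinI) (rule smooth_on_UNIV_frechet_derivative(1)[OF F])
  from vector_derivative_diff_chain_within[OF prc_curveD(1)[OF c] this]
  have "((F \<circ> (c \<circ> circle_param)) has_vector_derivative
      frechet_derivative F (at ((c \<circ> circle_param) u)) (vector_derivative (c \<circ> circle_param) (at u))) (at u)" for u .
  from vector_derivative_at[OF this] show ?thesis
    by (simp add: complex_velocity_def complex_loop_def comp_assoc)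
qed

text \<open>The image velocity has the winding number of its dominating term. The summand
  \<open>s\<close> comes from the Umlaufsatz, applied to the velocity or to its conjugate. The
  function \<open>g\<close> depends on \<open>F\<close> and \<open>s\<close> but not on the curve,
  so it can be shared by all boundary components.\<close>

lemma rotation_number_image:
  assumes F: "smooth_on UNIV F" and c: "positive_parametrization c \<gamma>"
    and sgn: "\<And>p. p \<in> \<gamma> \<Longrightarrow> sgn (det (matrix (frechet_derivative F (at p)))) = s"
    and s: "s = 1 \<or> s = - 1"
  defines "g \<equiv> \<lambda>z. (if s = 1 then linear_part else antilinear_part) (frechet_derivative F (at (vec_of_complex z)))"
  shows "rotation_number (F \<circ> c) = Re (winding_number (g \<circ> complex_loop c) 0) + s"
proof -
  have prc: "prc_curve c" using c by (simp add: positive_parametrization_def)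
  let ?A = "\<lambda>t. frechet_derivative F (at (vec_of_complex (complex_loop c t)))"
  define a where "a t = linear_part (?A t)" for t
  define b where "b t = antilinear_part (?A t)" for t
  define w where "w = complex_velocity c"
  have bl: "bounded_linear (frechet_derivative F (at x))" for x
    using smooth_on_UNIV_frechet_derivative(1)[OF F] by (rule has_derivative_bounded_linear)
  have vel: "complex_velocity (F \<circ> c) t = a t * w t + b t * cnj (w t)" for t
    unfolding complex_velocity_image[OF F prc] linear_antilinear_decomposition[OF bl]
    by (simp add: a_def b_def w_def)
  have cl: "continuous_on {0..1} (\<lambda>t. vec_of_complex (complex_loop c t))"
    using positive_parametrizationD(2)[OF c] unfolding path_def
    by (rule bounded_linear.continuous_on[OF bounded_linear_vec_of_complex])
  have cont: "continuous_on {0..1} (\<lambda>t. complex_of_vec (?A t v))" for v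
    by (intro bounded_linear.continuous_on[OF bounded_linear_complex_of_vec]
        continuous_on_compose2[OF smooth_on_UNIV_frechet_derivative(2)[OF F] cl]) auto
  have ca: "continuous_on {0..1} a" unfolding a_def linear_part_def by (intro continuous_intros cont) auto
  have cb: "continuous_on {0..1} b" unfolding b_def antilinear_part_def by (intro continuous_intros cont) auto
  have cw: "continuous_on {0..1} w" unfolding w_def by (rule continuous_on_subset[OF prc_curveD(2)[OF prc]]) simp
  have wnz: "w t \<noteq> 0" for t unfolding w_def by (rule prc_curveD(3)[OF prc])
  have loops: "a 1 = a 0" "b 1 = b 0" "w 1 = w 0"
    using complex_loop_periodic[of c 0] complex_velocity_periodic[OF prc, of 0] by (auto simp: a_def b_def w_def)
  have wn_w: "winding_number w 0 = 1" unfolding w_def by (rule winding_number_velocity[OF c])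
  have det: "sgn ((norm (a t))\<^sup>2 - (norm (b t))\<^sup>2) = s" if "t \<in> {0..1}" for t
  proof -
    have "complex_loop c t \<in> complex_of_vec ` \<gamma>"
      using that positive_parametrizationD(4)[OF c] by (auto simp: path_image_def)
    then have "vec_of_complex (complex_loop c t) \<in> \<gamma>" by auto
    from sgn[OF this] show ?thesis by (simp add: det_eq_linear_antilinear a_def b_def)
  qed
  show ?thesis
  proof (cases "s = 1")
    case True
    have "norm (b t) < norm (a t)" if "t \<in> {0..1}" for t
    proof -
      have "(norm (b t))\<^sup>2 < (norm (a t))\<^sup>2" using det[OF that] True by (simp add: sgn_1_pos)
      then show ?thesis by (rule power2_less_imp_less) simp
    qed
    from winding_number_conformal_dominates[OF ca cb cw wnz loops this]
    have "winding_number (complex_velocity (F \<circ> c)) 0 = winding_number a 0 + 1"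
      by (simp add: vel[abs_def] wn_w)
    moreover have "g \<circ> complex_loop c = a" using True by (simp add: g_def a_def o_def fun_eq_iff)
    ultimately show ?thesis using True by (simp add: rotation_number_eq)
  next
    case False
    then have s: "s = -1" using s by simp
    have less: "norm (a t) < norm (b t)" if "t \<in> {0..1}" for t
    proof -
      have "(norm (a t))\<^sup>2 < (norm (b t))\<^sup>2" using det[OF that] s by (simp add: sgn_1_neg)
      then show ?thesis by (rule power2_less_imp_less) simp
    qed
    \<comment> \<open>The domination lemma with the roles exchanged: \<open>b\<close> is the leading
      coefficient and \<open>cnj (w t)\<close> the vector it multiplies, whose winding number is
      -1.\<close>
    have "winding_number (\<lambda>t. b t * cnj (w t) + a t * cnj (cnj (w t))) 0
        = winding_number b 0 + winding_number (\<lambda>t. cnj (w t)) 0"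
      by (rule winding_number_conformal_dominates)
         (use wnz loops less in \<open>auto intro!: continuous_intros ca cb cw\<close>)
    also have "winding_number (\<lambda>t. cnj (w t)) 0 = - 1"
      using winding_number_cnj_0[OF cw wnz] wn_w by simp
    finally have "winding_number (complex_velocity (F \<circ> c)) 0 = winding_number b 0 - 1"
      by (simp add: vel[abs_def] add.commute)
    moreover have "g \<circ> complex_loop c = b" using False by (simp add: g_def b_def o_def fun_eq_iff)
    ultimately show ?thesis using s by (simp add: rotation_number_eq)
  qed
qed

section \<open>Combination over the boundary components\<close>

theorem proposition14:
  fixes F :: "real^2 \<Rightarrow> real^2"
    and n :: nat
    and \<gamma> :: "nat \<Rightarrow> (real^2) set"
    and c :: "nat \<Rightarrow> real^2 \<Rightarrow> real^2"
    and p :: "real^2"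
    and s :: real
  assumes "smooth_on UNIV F"
    and "excellent F"
    and "n \<ge> 1"
    and "\<And>i. i \<le> n \<Longrightarrow> smooth_simple_closed_curve (\<gamma> i)"
    and "\<And>i. i \<le> n \<Longrightarrow> positive_parametrization (c i) (\<gamma> i)"
    and "bounds_disk_with_holes n \<gamma>"
    and "disk_with_holes n \<gamma> \<inter> critical_set F = {}"
    and "p \<in> disk_with_holes n \<gamma>"
    and "s = sgn (det (matrix (frechet_derivative F (at p))))"
  shows "rotation_number (F \<circ> c 0) =
           (\<Sum>i=1..n. rotation_number (F \<circ> c i)) - s * (real n - 1)"
proof -
  let ?DF = "\<lambda>z. frechet_derivative F (at (vec_of_complex z))"
  note F = assms(1) and pos = assms(5)
  have disk_eq: "path_image (complex_loop (c i)) \<union> inside (path_image (complex_loop (c i)))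
      = complex_of_vec ` closed_disk (\<gamma> i)" if "i \<le> n" for i
    by (simp add: positive_parametrizationD(4)[OF pos[OF that]] inside_complex_of_vec closed_disk_def image_Un)
  interpret holed_disk n "\<lambda>i. complex_loop (c i)"
  proof
    fix i assume i: "i \<le> n"
    show "simple_path (complex_loop (c i))"
      unfolding simple_path_def loop_free_def
    proof (intro conjI ballI impI)
      fix s t :: real assume st: "s \<in> {0..1}" "t \<in> {0..1}" "complex_loop (c i) s = complex_loop (c i) t"
      then obtain k :: int where k: "s - t = of_int k"
        using positive_parametrizationD(1)[OF pos[OF i]] by (auto simp: Ints_def)
      \<comment> \<open>On the closed interval equal points have parameters differing by -1, 0 or 1;
        the extreme values occur only for the two end points.\<close>
      then have "-1 \<le> k" "k \<le> 1" using st(1,2) by auto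
      then consider "k = -1" | "k = 0" | "k = 1" by linarith
      then show "s = t \<or> s = 0 \<and> t = 1 \<or> s = 1 \<and> t = 0" using k st(1,2) by cases auto
    qed (rule positive_parametrizationD(2)[OF pos[OF i]])
    show "pathfinish (complex_loop (c i)) = pathstart (complex_loop (c i))"
      by (rule positive_parametrizationD(3)[OF pos[OF i]])
    show "winding_number (complex_loop (c i)) z = 1" if "z \<in> inside (path_image (complex_loop (c i)))" for z
      by (rule positive_parametrizationD(5)[OF pos[OF i] that])
  next
    fix i assume i: "i \<in> {1..n}"
    have "closed_disk (\<gamma> i) \<subseteq> inside (\<gamma> 0)" using assms(6) i by (auto simp: bounds_disk_with_holes_def)
    then show "path_image (complex_loop (c i)) \<union> inside (path_image (complex_loop (c i)))
        \<subseteq> inside (path_image (complex_loop (c 0)))"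
      using i unfolding positive_parametrizationD(4)[OF pos[OF le0]]
      by (subst disk_eq) (auto simp: inside_complex_of_vec)
  next
    show "disjoint_family_on (\<lambda>i. path_image (complex_loop (c i)) \<union> inside (path_image (complex_loop (c i)))) {1..n}"
      unfolding disjoint_family_on_def
    proof (intro ballI impI)
      fix i j assume ij: "i \<in> {1..n}" "j \<in> {1..n}" "i \<noteq> j"
      then have "closed_disk (\<gamma> i) \<inter> closed_disk (\<gamma> j) = {}"
        using assms(6) unfolding bounds_disk_with_holes_def disjoint_family_on_def by blast
      then show "(path_image (complex_loop (c i)) \<union> inside (path_image (complex_loop (c i)))) \<inter>
          (path_image (complex_loop (c j)) \<union> inside (path_image (complex_loop (c j)))) = {}"
        using ij by (subst (1 2) disk_eq) auto
    qed
  qed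
  have region_eq: "region = complex_of_vec ` disk_with_holes n \<gamma>"
  proof -
    have "region = complex_of_vec ` closed_disk (\<gamma> 0) - (\<Union>i\<in>{1..n}. complex_of_vec ` inside (\<gamma> i))"
      by (simp add: region_def disk_def disk_eq positive_parametrizationD(4)[OF pos] inside_complex_of_vec
          closed_disk_def image_Un)
    then show ?thesis by (auto simp: disk_with_holes_def)
  qed
  have det_nz: "det (matrix (?DF z)) \<noteq> 0" if "z \<in> region" for z
  proof -
    have "vec_of_complex z \<notin> critical_set F" using that assms(7) by (auto simp: region_eq)
    then show ?thesis by (simp add: critical_set_def invertible_det_nz)
  qed
  have "continuous_on UNIV (\<lambda>z. frechet_derivative F (at (vec_of_complex z)) v)" for v
    by (rule continuous_on_compose2[OF smooth_on_UNIV_frechet_derivative(2)[OF F]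
        bounded_linear.continuous_on[OF bounded_linear_vec_of_complex continuous_on_id]]) auto
  then have cont: "continuous_on region (\<lambda>z. complex_of_vec (frechet_derivative F (at (vec_of_complex z)) v))" for v
    by (rule bounded_linear.continuous_on[OF bounded_linear_complex_of_vec continuous_on_subset[OF _ subset_UNIV]])
  have lin: "continuous_on region (\<lambda>z. linear_part (?DF z))"
    unfolding linear_part_def by (intro continuous_intros cont) auto
  have antilin: "continuous_on region (\<lambda>z. antilinear_part (?DF z))"
    unfolding antilinear_part_def by (intro continuous_intros cont) auto
  have "continuous_on region (\<lambda>z. det (matrix (?DF z)))"
    unfolding det_eq_linear_antilinear by (intro continuous_intros lin antilin)
  then have "sgn (det (matrix (?DF z))) = sgn (det (matrix (?DF (complex_of_vec p))))" if "z \<in> region" for z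
    by (rule sgn_constant_on_region) (use det_nz that assms(8) in \<open>auto simp: region_eq\<close>)
  then have sgn: "sgn (det (matrix (?DF z))) = s" if "z \<in> region" for z using that assms(9) by simp
  have "complex_of_vec p \<in> region" using assms(8) by (simp add: region_eq)
  from det_nz[OF this] have s: "s = 1 \<or> s = -1"
    using assms(9) by (auto simp: sgn_real_def)
  define g where "g z = (if s = 1 then linear_part else antilinear_part) (?DF z)" for z
  have gcont: "continuous_on region g" unfolding g_def using lin antilin by (cases "s = 1") auto
  \<comment> \<open>A zero of the dominating coefficient would leave the determinant with the
    opposite sign or zero.\<close>
  have gnz: "g z \<noteq> 0" if "z \<in> region" for z
  proof
    assume "g z = 0"
    moreover have "sgn ((norm (linear_part (?DF z)))\<^sup>2 - (norm (antilinear_part (?DF z)))\<^sup>2) = s"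
      using sgn[OF that] by (simp add: det_eq_linear_antilinear)
    ultimately show False using s by (auto simp: g_def sgn_real_def split: if_splits)
  qed
  have rot: "rotation_number (F \<circ> c i) = Re (winding_number (g \<circ> complex_loop (c i)) 0) + s" if i: "i \<le> n" for i
  proof -
    have "sgn (det (matrix (frechet_derivative F (at q)))) = s" if "q \<in> \<gamma> i" for q
    proof -
      have "complex_of_vec q \<in> region"
        using path_image_subset_region[OF i] that positive_parametrizationD(4)[OF pos[OF i]] by auto
      from sgn[OF this] show ?thesis by simp
    qed
    from rotation_number_image[OF F pos[OF i] this s] show ?thesis
      by (simp add: g_def[abs_def])
  qed
  have "Re (winding_number (g \<circ> complex_loop (c 0)) 0) = (\<Sum>i=1..n. Re (winding_number (g \<circ> complex_loop (c i)) 0))"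
    using winding_number_boundary_sum[OF gcont gnz] by (simp only: Re_sum)
  \<comment> \<open>Every curve contributes one \<open>s\<close>: once on the left and
    \<open>n\<close> times in the sum, which leaves the correction
    \<open>- s * (real n - 1)\<close>.\<close>
  then show ?thesis by (simp add: rot sum.distrib algebra_simps)
qed

end
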